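(* Let $\mathbf R$ be a commutative ring with unity $1$ and zero $0$; let $x=(x_1,\ldots,x_n)$, $f(x)=(f_1(x),\ldots,f_s(x))\in\mathbf R[x]^s$, $F(x)=(F_1(x),\ldots,F_t(x))\in\mathbf R[x]^t$, and let $\partial:\widehat f_x,\widehat f'_x\mapsto f(x)$, $\widehat F_x,\widehat F'_x\mapsto F(x)$. Then $$\partial\left[x^0\det\|\widehat F'^x_*\|\exp(\widehat f_x\widehat f'^x_* )\right]=0\qquad\text{and}\qquad \partial\left[x^0(\widehat F_x)^0\exp(\widehat f_x\widehat f'^x_* )\right]=0,$$ and hence the following four maps are complex morphisms: (a) $\mathbf C(x,\widehat f_x,\widehat F_x)\to\mathbf C(x,\widehat f_x)$, $\ c(x,\widehat f_x,\widehat F_x)\mapsto \mathop{\top}\limits_{\widehat f'_x}\mathop{\top}\limits_{\widehat F'_x}x^0\det\|\widehat F'^x_*\|\exp(\widehat f_x\widehat f'^x_* )\,c(x,\widehat f'_x,\widehat F'_x)=\mathop{\top}\limits_{\widehat F_x}\det\|\widehat F^x_*\|\,c(x,\widehat f_x,\widehat F_x)$; (b) $\mathbf C(x_*,\widehat f^x_* )\to\mathbf C(x_*,\widehat f^x_*,\widehat F^x_* )$, $\ c(x_*,\widehat f^x_* )\mapsto\mathop{\bot}\limits_{x}\mathop{\top}\limits_{\widehat f'_x}x^0\det\|\widehat F^x_*\|\exp(\widehat f'_x\widehat f^x_* )\,c(x_*,\widehat f'^x_* )=\det\|\widehat F^x_*\|\,c(x_*,\widehat f^x_* )$; (c) $\mathbf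 C(x,\widehat f_x)\to\mathbf C(x,\widehat f_x,\widehat F_x)$, $\ c(x,\widehat f_x)\mapsto\mathop{\top}\limits_{\widehat f'_x}x^0(\widehat F_x)^0\exp(\widehat f_x\widehat f'^x_* )\,c(x,\widehat f'_x)=(\widehat F_x)^0c(x,\widehat f_x)$; (d) $\mathbf C(x_*,\widehat f^x_*,\widehat F^x_* )\to\mathbf C(x_*,\widehat f^x_* )$, $\ c(x_*,\widehat f^x_*,\widehat F^x_* )\mapsto\mathop{\bot}\limits_{x}\mathop{\top}\limits_{\widehat f'_x}\mathop{\top}\limits_{\widehat F'_x}x^0(\widehat F'_x)^0\exp(\widehat f'_x\widehat f^x_* )\,c(x_*,\widehat f'^x_*,\widehat F'^x_* )=\mathop{\top}\limits_{\widehat F_x}(\widehat F_x)^0c(x_*,\widehat f^x_*,\widehat F^x_* )$.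
   Context: Variables. $\widehat f_x,\widehat f'_x$ are collections of $s$ Grassmann (anticommuting, square-zero) variables, $\widehat F_x,\widehat F'_x$ collections of $t$ such variables; variables from different collections also anticommute. $\Lambda_A(\widehat v)$ is the Grassmann algebra in $\widehat v$ over a commutative ring $A$; $|w|\in\mathbb Z/2$ denotes parity of a homogeneous element or linear map. A zeroth power $x^0$, $(\widehat F_x)^0$ denotes the element $1$. Complexes. $\mathbf C(x,\widehat f_x)=\Lambda_{\mathbf R[x]}(\widehat f_x)$ with the differential $\partial$ that is the odd $\mathbf R[x]$-linear derivation, $\partial(ab)=\partial(a)b+(-1)^{|a|}a\,\partial(b)$, with $\partial(\widehat f_{i,x})=f_i(x)$ (Koszul complex); $\mathbf C(x,\widehat f_x,\widehat F_x)=\Lambda_{\mathbf R[x]}(\widehat f_x,\widehat F_x)$ with $\partial(\widehat f_{i,x})=f_i(x)$, $\partial(\widehat F_{j,x})=F_j(x)$. The dual complexes are $\mathbf C(x_*,\widehat f^x_* )=\mathrm{Hom}_{\mathbf R}(\mathbf C(x,\widehat f_x),\mathbf R)$ and $\mathbf C(x_*,\widehat f^x_*,\widehat F^x_* )=\mathrm{Hom}_{\mathbf R}(\mathbf C(x,\widehat f_x,\widehat F_x),\mathbf R)$. For a homogeneous linear map $\varphi$ between complexes, $\partial[\varphi]=\partial\circ\varphi-(-1)^{|\varphi|}\varphi\circ\partial$; in particular $\partial[L]=-(-1)^{|L|}L\circ\partial$ for a functional $L$ with values in $\mathbf R$. A homogeneous linear map $\varphi$ of complexes is a complex morphism if $\partial[\varphi]=0$,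 i.e. $\partial\circ\varphi=(-1)^{|\varphi|}\varphi\circ\partial$. Functionals and contraction. A homogeneous linear map $\varphi$ on functions of Grassmann variables is extended to depend on additional Grassmann parameters $\theta$ by $\varphi(\theta w)=(-1)^{|\varphi||\theta|}\theta\varphi(w)$. $\mathop{\top}\limits_{v}\varphi\,w=\varphi(w)$ denotes application of $\varphi$ (a functional in the variables $v$) to $w$ (a function of $v$). $\mathop{\bot}\limits_x$ indicates that functions of $x$ act on functionals in $x$ by $(a\cdot l)(h)=l(ah)$. The product of functionals is composition (right factor applied first). $\det\|\widehat v_*\|$ for $\widehat v=(\widehat v_1,\ldots,\widehat v_m)$ is the linear functional of parity $m \bmod 2$ on $\Lambda_A(\widehat v)$ equal to $1$ on $\widehat v_1\widehat v_2\cdots\widehat v_m$ and $0$ on all other monomials. $\exp(\widehat f_x\widehat f'^x_* )$ is the $\mathbf R[x]$-linear algebra homomorphism substituting $\widehat f'_{i,x}\mapsto\widehat f_{i,x}$ (and similarly $\exp(\widehat f'_x\widehat f^x_* )$ substitutes $\widehat f_{i,x}\mapsto\widehat f'_{i,x}$). Thus $x^0\det\|\widehat F'^x_*\|\exp(\widehat f_x\widehat f'^x_* )$ is an $\mathbf R[x]$-linear map $\Lambda_{\mathbf R[x]}(\widehat f'_x,\widehat F'_x)\to\Lambda_{\mathbf R[x]}(\widehat f_x)$ of parity $t$, and $x^0(\widehat F_x)^0\exp(\widehat f_x\widehat f'^x_* )$ is the inclusion $\Lambda_{\mathbf R[x]}(\widehat f'_x)\to\Lambda_{\mathbf R[x]}(\widehat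 f_x,\widehat F_x)$, $\widehat f'_{i,x}\mapsto\widehat f_{i,x}$. Explicitly, $\det\|\widehat F^x_*\|\,c$ in (b) is the functional $w\mapsto(-1)^{t|c|}c\left(\det\|\widehat F^x_*\|.w\right)$, where $\det\|\widehat F^x_*\|.w\in\Lambda_{\mathbf R[x]}(\widehat f_x)$, and $\mathop{\top}\limits_{\widehat F_x}(\widehat F_x)^0c$ in (d) is the restriction of $c$ to $\mathbf C(x,\widehat f_x)\subset\mathbf C(x,\widehat f_x,\widehat F_x)$. *)

theory Defs
  imports
    "HOL-Library.Poly_Mapping"
    "HOL-Library.Product_Lexorder"
    "HOL-Library.FuncSet"
    "HOL-Library.Z2"
begin

section \<open>Coefficients\<close>

text \<open>
  The sort \<open>{comm_ring, comm_monoid_mult}\<close> of the ground ring describes exactly the commutative rings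
  with unity; unlike \<open>comm_ring_1\<close> it does not exclude the zero ring. The price is that the
  polynomial type has no \<open>1\<close> at this sort, so \<open>pconst 1\<close> is used. Polynomials in
  \<open>x\<^sub>1, \<dots>, x\<^sub>n\<close> are those polynomials in countably many variables that involve only the variables
  with index below \<open>n\<close>.
\<close>

type_synonym 'r mpoly = "(nat \<Rightarrow>\<^sub>0 nat) \<Rightarrow>\<^sub>0 'r"

definition Rx :: "nat \<Rightarrow> 'r::zero mpoly set" where
  "Rx n = {p. \<forall>m \<in> Poly_Mapping.keys p. Poly_Mapping.keys m \<subseteq> {..<n}}"

definition pconst :: "'r::zero \<Rightarrow> 'r mpoly" where
  "pconst r = Poly_Mapping.single 0 r"

text \<open>\<open>sg p a\<close> is \<open>(-1)\<^sup>p a\<close> for a parity \<open>p\<close> in \<open>\<int>/2\<close>.\<close>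

definition sg :: "bit \<Rightarrow> 'a::uminus \<Rightarrow> 'a" where
  "sg p a = (if p = 0 then a else - a)"


section \<open>Grassmann algebras\<close>

text \<open>
  All Grassmann variables live in one family: \<open>(Blf, i)\<close>, \<open>(Blf', i)\<close>, \<open>(BlF, j)\<close>, \<open>(BlF', j)\<close> are
  the \<open>i\<close>-th variable of \<open>f\<close>, of \<open>f'\<close>, and the \<open>j\<close>-th variable of \<open>F\<close>, of \<open>F'\<close> (indices start at 0).
  They are ordered lexicographically. An element of a Grassmann algebra is given by its coefficients
  with respect to the basis of monomials \<open>v\<^sub>1 \<cdots> v\<^sub>k\<close> with \<open>v\<^sub>1 < \<dots> < v\<^sub>k\<close>, indexed by
  the set \<open>{v\<^sub>1, \<dots>, v\<^sub>k}\<close>.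
\<close>

datatype block = Blf | Blf' | BlF | BlF'

fun block_rank :: "block \<Rightarrow> nat" where
  "block_rank Blf = 0"
| "block_rank Blf' = 1"
| "block_rank BlF = 2"
| "block_rank BlF' = 3"

instantiation block :: linorder
begin

definition less_eq_block :: "block \<Rightarrow> block \<Rightarrow> bool" where
  "a \<le> b \<longleftrightarrow> block_rank a \<le> block_rank b"

definition less_block :: "block \<Rightarrow> block \<Rightarrow> bool" where
  "a < b \<longleftrightarrow> block_rank a < block_rank b"

instance
proof
  fix a b :: block
  show "a \<le> b \<Longrightarrow> b \<le> a \<Longrightarrow> a = b"
    by (cases a; cases b) (simp_all add: less_eq_block_def)
qed (auto simp: less_eq_block_def less_block_def)

end

type_synonym gvar = "block \<times> nat"

type_synonym 'r grass = "gvar set \<Rightarrow>\<^sub>0 'r mpoly"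

definition vars :: "block \<Rightarrow> nat \<Rightarrow> gvar set" where
  "vars b m = {b} \<times> {..<m}"

definition grass_alg :: "nat \<Rightarrow> gvar set \<Rightarrow> 'r::zero grass set" where
  "grass_alg n V = {w. \<forall>S \<in> Poly_Mapping.keys w. S \<subseteq> V \<and> Poly_Mapping.lookup w S \<in> Rx n}"

definition lin_ext :: "(gvar set \<Rightarrow> 'r::zero mpoly \<Rightarrow> 'c::comm_monoid_add) \<Rightarrow> 'r grass \<Rightarrow> 'c" where
  "lin_ext \<phi> w = (\<Sum>S \<in> Poly_Mapping.keys w. \<phi> S (Poly_Mapping.lookup w S))"

definition gmono :: "gvar set \<Rightarrow> 'r::{comm_ring,comm_monoid_mult} grass" where
  "gmono S = Poly_Mapping.single S (pconst 1)"

abbreviation gone :: "'r::{comm_ring,comm_monoid_mult} grass" where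
  "gone \<equiv> gmono {}"

abbreviation gen :: "gvar \<Rightarrow> 'r::{comm_ring,comm_monoid_mult} grass" where
  "gen v \<equiv> gmono {v}"

definition gscale :: "'r::comm_ring mpoly \<Rightarrow> 'r grass \<Rightarrow> 'r grass" where
  "gscale a w = Poly_Mapping.map ((*) a) w"

text \<open>Number of transpositions needed to sort the increasing word of \<open>S\<close> followed by that of \<open>T\<close>.\<close>

definition inversions :: "gvar set \<Rightarrow> gvar set \<Rightarrow> nat" where
  "inversions S T = card {(a, b). a \<in> S \<and> b \<in> T \<and> b < a}"

definition gmult :: "'r::comm_ring grass \<Rightarrow> 'r grass \<Rightarrow> 'r grass" (infixl \<open>\<star>\<close> 70) where
  "w \<star> u = lin_ext (\<lambda>S a. lin_ext (\<lambda>T b.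
     if S \<inter> T = {} then Poly_Mapping.single (S \<union> T) (sg (of_nat (inversions S T)) (a * b)) else 0) u) w"

text \<open>Component of parity \<open>p\<close>.\<close>

definition gpart :: "bit \<Rightarrow> 'r::comm_ring grass \<Rightarrow> 'r grass" where
  "gpart p = lin_ext (\<lambda>S a. if of_nat (card S) = p then Poly_Mapping.single S a else 0)"


section \<open>Complexes, their duals, and morphisms\<close>

text \<open>
  A \<open>\<int>/2\<close>-graded \<open>R[x]\<close>-module with an endomorphism \<open>cdiff\<close>; \<open>cpart p\<close> is the projection onto
  the component of parity \<open>p\<close>.
\<close>

record ('a, 'c) cplx =
  car :: "'c set"
  czero :: 'c
  cadd :: "'c \<Rightarrow> 'c \<Rightarrow> 'c"
  csmul :: "'a \<Rightarrow> 'c \<Rightarrow> 'c"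
  cpart :: "bit \<Rightarrow> 'c \<Rightarrow> 'c"
  cdiff :: "'c \<Rightarrow> 'c"

definition hom_elems :: "('a, 'c) cplx \<Rightarrow> bit \<Rightarrow> 'c set" where
  "hom_elems K p = {c \<in> car K. cpart K p c = c}"

text \<open>
  Homogeneous linear maps of parity \<open>p\<close>. Linearity is over \<open>R[x]\<close>, which acts on functionals by
  \<open>(a \<cdot> l)(h) = l (a h)\<close>; it contains linearity over \<open>R\<close>, since \<open>pconst r\<close> is in \<open>Rx n\<close>.
\<close>

definition graded_map ::
  "nat \<Rightarrow> bit \<Rightarrow> ('r::zero mpoly, 'c) cplx \<Rightarrow> ('r mpoly, 'e) cplx \<Rightarrow> ('c \<Rightarrow> 'e) \<Rightarrow> bool" where
  "graded_map n p K L \<phi> \<longleftrightarrow>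
     (\<forall>c \<in> car K. \<phi> c \<in> car L) \<and>
     (\<forall>c \<in> car K. \<forall>c' \<in> car K. \<phi> (cadd K c c') = cadd L (\<phi> c) (\<phi> c')) \<and>
     (\<forall>a \<in> Rx n. \<forall>c \<in> car K. \<phi> (csmul K a c) = csmul L a (\<phi> c)) \<and>
     (\<forall>q. \<forall>c \<in> hom_elems K q. \<phi> c \<in> hom_elems L (p + q))"

text \<open>\<open>bracket p K L \<phi>\<close> is \<open>\<partial>[\<phi>] = \<partial> \<circ> \<phi> - (-1)\<^sup>p \<phi> \<circ> \<partial>\<close> for \<open>\<phi>\<close> of parity \<open>p\<close>.\<close>

definition bracket ::
  "bit \<Rightarrow> ('r::{comm_ring,comm_monoid_mult} mpoly, 'c) cplx \<Rightarrow> ('r mpoly, 'e) cplx \<Rightarrow> ('c \<Rightarrow> 'e) \<Rightarrow> 'c \<Rightarrow> 'e" where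
  "bracket p K L \<phi> c =
     cadd L (cdiff L (\<phi> c)) (csmul L (- sg p (pconst 1)) (\<phi> (cdiff K c)))"

definition complex_morphism ::
  "nat \<Rightarrow> bit \<Rightarrow> ('r::{comm_ring,comm_monoid_mult} mpoly, 'c) cplx \<Rightarrow> ('r mpoly, 'e) cplx \<Rightarrow> ('c \<Rightarrow> 'e) \<Rightarrow> bool" where
  "complex_morphism n p K L \<phi> \<longleftrightarrow>
     graded_map n p K L \<phi> \<and> (\<forall>c \<in> car K. bracket p K L \<phi> c = czero L)"

definition grass_cplx ::
  "nat \<Rightarrow> gvar set \<Rightarrow> ('r::comm_ring grass \<Rightarrow> 'r grass) \<Rightarrow> ('r mpoly, 'r grass) cplx" where
  "grass_cplx n V d =
     \<lparr>car = grass_alg n V, czero = 0, cadd = (+), csmul = gscale, cpart = gpart, cdiff = d\<rparr>"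

text \<open>
  \<open>d\<close> is the odd \<open>R[x]\<close>-linear derivation of the Grassmann algebra in \<open>V\<close> with \<open>d v = g v\<close>
  for \<open>v \<in> V\<close>.
\<close>

definition koszul_differential ::
  "nat \<Rightarrow> gvar set \<Rightarrow> (gvar \<Rightarrow> 'r::{comm_ring,comm_monoid_mult} mpoly) \<Rightarrow> ('r grass \<Rightarrow> 'r grass) \<Rightarrow> bool" where
  "koszul_differential n V g d \<longleftrightarrow>
     graded_map n 1 (grass_cplx n V d) (grass_cplx n V d) d \<and>
     (\<forall>p. \<forall>a \<in> hom_elems (grass_cplx n V d) p. \<forall>b \<in> grass_alg n V.
        d (a \<star> b) = d a \<star> b + sg p (a \<star> d b)) \<and>
     (\<forall>v \<in> V. d (gen v) = gscale (g v) gone)"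

text \<open>
  \<open>Hom\<^sub>R(K, R)\<close>. The component of parity \<open>p\<close> of a functional \<open>L\<close> is \<open>L\<close> composed with the projection
  onto the component of parity \<open>p\<close>, and \<open>\<partial>[L] = -(-1)\<^sup>p L \<circ> \<partial>\<close> for \<open>L\<close> of parity \<open>p\<close> is
  extended additively to all \<open>L\<close>.
\<close>

definition dual_cplx ::
  "('r::{comm_ring,comm_monoid_mult} mpoly, 'c) cplx \<Rightarrow> ('r mpoly, 'c \<Rightarrow> 'r) cplx" where
  "dual_cplx K =
     \<lparr>car = {L \<in> extensional (car K).
              (\<forall>u \<in> car K. \<forall>w \<in> car K. L (cadd K u w) = L u + L w) \<and>
              (\<forall>r. \<forall>w \<in> car K. L (csmul K (pconst r) w) = r * L w)},
      czero = (\<lambda>w \<in> car K. 0),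
      cadd = (\<lambda>L M. \<lambda>w \<in> car K. L w + M w),
      csmul = (\<lambda>a L. \<lambda>w \<in> car K. L (csmul K a w)),
      cpart = (\<lambda>p L. \<lambda>w \<in> car K. L (cpart K p w)),
      cdiff = (\<lambda>L. \<lambda>w \<in> car K. - L (cpart K 0 (cdiff K w)) + L (cpart K 1 (cdiff K w)))\<rparr>"

text \<open>
  For \<open>\<phi>\<close> from \<open>K\<close> to \<open>L\<close> of parity \<open>p\<close>, \<open>pull p K L \<phi>\<close> sends a functional \<open>c\<close> on \<open>L\<close> of
  parity \<open>q\<close> to the functional \<open>w \<mapsto> (-1)\<^sup>p\<^sup>q c (\<phi> w)\<close> on \<open>K\<close>; this is extended additively to all \<open>c\<close>.
\<close>

definition pull ::
  "bit \<Rightarrow> ('r::{comm_ring,comm_monoid_mult} mpoly, 'c) cplx \<Rightarrow> ('r mpoly, 'e) cplx \<Rightarrow> ('c \<Rightarrow> 'e)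
     \<Rightarrow> ('e \<Rightarrow> 'r) \<Rightarrow> ('c \<Rightarrow> 'r)" where
  "pull p K L \<phi> c =
     (\<lambda>w \<in> car K. cpart (dual_cplx L) 0 c (\<phi> w) + sg p (cpart (dual_cplx L) 1 c (\<phi> w)))"


section \<open>Functionals and substitutions\<close>

text \<open>
  Extension of a functional \<open>\<phi>\<close> of parity \<open>p\<close> on functions of the variables \<open>V\<close> to functions that
  also depend on other Grassmann variables, by \<open>\<phi>(\<theta> w) = (-1)\<^sup>p\<^sup>|\<^sup>\<theta>\<^sup>| \<theta> \<phi>(w)\<close>. The sign given by
  \<open>inversions\<close> comes from writing the monomial of \<open>S\<close> as the product of the monomials of \<open>S - V\<close>
  and \<open>S \<inter> V\<close>.
\<close>

definition param_ext ::
  "gvar set \<Rightarrow> bit \<Rightarrow> ('r::{comm_ring,comm_monoid_mult} grass \<Rightarrow> 'r mpoly) \<Rightarrow> 'r grass \<Rightarrow> 'r grass" where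
  "param_ext V p \<phi> = lin_ext (\<lambda>S a. Poly_Mapping.single (S - V)
     (sg (of_nat (inversions (S - V) (S \<inter> V)) + p * of_nat (card (S - V))) (a * \<phi> (gmono (S \<inter> V)))))"

text \<open>The functional that is 1 on the product of all variables of \<open>V\<close> in increasing order.\<close>

definition det_fun :: "gvar set \<Rightarrow> 'r::zero grass \<Rightarrow> 'r mpoly" where
  "det_fun V w = Poly_Mapping.lookup w V"

definition det_op :: "gvar set \<Rightarrow> 'r::{comm_ring,comm_monoid_mult} grass \<Rightarrow> 'r grass" where
  "det_op V = param_ext V (of_nat (card V)) (det_fun V)"

text \<open>The \<open>R[x]\<close>-linear algebra homomorphism with \<open>v \<mapsto> \<sigma> v\<close> on Grassmann variables.\<close>

definition gsubst :: "(gvar \<Rightarrow> gvar) \<Rightarrow> 'r::{comm_ring,comm_monoid_mult} grass \<Rightarrow> 'r grass" where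
  "gsubst \<sigma> = lin_ext (\<lambda>S a.
     gscale a (foldr (\<lambda>v w. gen (\<sigma> v) \<star> w) (sorted_list_of_set S) gone))"

text \<open>\<open>exp_subst b b'\<close> is \<open>exp(b b'\<^sub>*)\<close>: the variables of block \<open>b'\<close> are replaced by those of \<open>b\<close>.\<close>

definition exp_subst :: "block \<Rightarrow> block \<Rightarrow> 'r::{comm_ring,comm_monoid_mult} grass \<Rightarrow> 'r grass" where
  "exp_subst b b' = gsubst (\<lambda>(k, i). (if k = b' then b else k, i))"

fun prime_block :: "block \<Rightarrow> block" where
  "prime_block Blf = Blf'"
| "prime_block BlF = BlF'"
| "prime_block b = b"

fun unprime_block :: "block \<Rightarrow> block" where
  "unprime_block Blf' = Blf"
| "unprime_block BlF' = BlF"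
| "unprime_block b = b"

text \<open>\<open>c(x, f, F) \<mapsto> c(x, f', F')\<close> and its inverse\<close>

definition prime :: "'r::{comm_ring,comm_monoid_mult} grass \<Rightarrow> 'r grass" where
  "prime = gsubst (map_prod prime_block id)"

definition unprime :: "'r::{comm_ring,comm_monoid_mult} grass \<Rightarrow> 'r grass" where
  "unprime = gsubst (map_prod unprime_block id)"

text \<open>
  For a functional \<open>c\<close> of unprimed variables, the same functional of the primed variables \<open>V'\<close>,
  that is \<open>c(x\<^sub>*, f'\<^sub>*)\<close> or \<open>c(x\<^sub>*, f'\<^sub>*, F'\<^sub>*)\<close>.
\<close>

definition prime_fun ::
  "nat \<Rightarrow> gvar set \<Rightarrow> ('r::{comm_ring,comm_monoid_mult} grass \<Rightarrow> 'r) \<Rightarrow> 'r grass \<Rightarrow> 'r" where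
  "prime_fun n V' c = (\<lambda>w \<in> grass_alg n V'. c (unprime w))"

text \<open>Multiplication by the zeroth powers \<open>x\<^sup>0 = 1\<close> and \<open>F\<^sup>0 = 1\<close>.\<close>

definition x0 :: "'r::{comm_ring,comm_monoid_mult} grass \<Rightarrow> 'r grass" where
  "x0 w = gscale (pconst 1) w"

definition F0 :: "'r::{comm_ring,comm_monoid_mult} grass \<Rightarrow> 'r grass" where
  "F0 w = gone \<star> w"

text \<open>
  \<open>det_exp b b' B t\<close> is \<open>x\<^sup>0 det\<parallel>B\<^sub>*\<parallel> exp(b b'\<^sub>*)\<close> for the block \<open>B\<close> of \<open>t\<close> variables, and
  \<open>unit_exp b b'\<close> is \<open>x\<^sup>0 F\<^sup>0 exp(b b'\<^sub>*)\<close>.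
\<close>

definition det_exp ::
  "block \<Rightarrow> block \<Rightarrow> block \<Rightarrow> nat \<Rightarrow> 'r::{comm_ring,comm_monoid_mult} grass \<Rightarrow> 'r grass" where
  "det_exp b b' B t = x0 \<circ> det_op (vars B t) \<circ> exp_subst b b'"

definition unit_exp ::
  "block \<Rightarrow> block \<Rightarrow> 'r::{comm_ring,comm_monoid_mult} grass \<Rightarrow> 'r grass" where
  "unit_exp b b' = x0 \<circ> F0 \<circ> exp_subst b b'"

fun gval :: "(nat \<Rightarrow> 'r mpoly) \<Rightarrow> (nat \<Rightarrow> 'r mpoly) \<Rightarrow> gvar \<Rightarrow> 'r mpoly" where
  "gval f F (Blf, i) = f i"
| "gval f F (Blf', i) = f i"
| "gval f F (BlF, j) = F j"
| "gval f F (BlF', j) = F j"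

abbreviation "cplx_f n s d \<equiv> grass_cplx n (vars Blf s) d"
abbreviation "cplx_f' n s d \<equiv> grass_cplx n (vars Blf' s) d"
abbreviation "cplx_fF n s t d \<equiv> grass_cplx n (vars Blf s \<union> vars BlF t) d"
abbreviation "cplx_f'F' n s t d \<equiv> grass_cplx n (vars Blf' s \<union> vars BlF' t) d"


section \<open>Existence of the differential\<close>

text \<open>
  The predicate \<open>koszul_differential\<close> is satisfied by the usual Koszul formula, and the extension
  rule and the multiplication have the expected values on monomials.
\<close>

lemma sg_simps [simp]:
  "sg 0 a = a" "sg 1 a = - a"
  by (simp_all add: sg_def)

lemma sg_zero [simp]: "sg p (0 :: 'a::ab_group_add) = 0"
  by (cases p) simp_all

lemma sg_sg: "sg p (sg q (a :: 'a::ab_group_add)) = sg (p + q) a"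
  by (cases p; cases q) simp_all

lemma sg_add: "sg p (a + b :: 'a::ab_group_add) = sg p a + sg p b"
  by (cases p) simp_all

lemma sg_succ_add: "sg (1 + p) (a :: 'a::ab_group_add) + sg p a = 0"
  by (cases p) simp_all

lemma sg_mult_left: "sg p (a :: 'a::ring) * b = sg p (a * b)"
  by (cases p) simp_all

lemma sg_mult_right: "(a :: 'a::ring) * sg p b = sg p (a * b)"
  by (cases p) simp_all

lemma single_sg: "Poly_Mapping.single S (sg p (a :: 'a::ab_group_add)) = sg p (Poly_Mapping.single S a)"
  by (cases p) (simp_all add: single_uminus)

lemma lin_ext_finite:
  assumes "finite A" "Poly_Mapping.keys w \<subseteq> A" "\<And>S. \<phi> S 0 = 0"
  shows "lin_ext \<phi> w = (\<Sum>S\<in>A. \<phi> S (Poly_Mapping.lookup w S))"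
  unfolding lin_ext_def
  by (rule sum.mono_neutral_left) (use assms in \<open>auto simp: in_keys_iff\<close>)

lemma lin_ext_zero [simp]: "lin_ext \<phi> 0 = 0"
  by (simp add: lin_ext_def)

lemma lin_ext_single [simp]:
  assumes "\<And>S. \<phi> S 0 = 0"
  shows "lin_ext \<phi> (Poly_Mapping.single S a) = \<phi> S a"
  using assms by (subst lin_ext_finite[of "{S}"]) auto

lemma lin_ext_add:
  assumes "\<And>S. \<phi> S 0 = 0" "\<And>S a b. \<phi> S (a + b) = \<phi> S a + \<phi> S b"
  shows "lin_ext \<phi> (w + u) = lin_ext \<phi> w + lin_ext \<phi> u"
proof -
  let ?A = "Poly_Mapping.keys w \<union> Poly_Mapping.keys u"
  have "Poly_Mapping.keys (w + u) \<subseteq> ?A"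
    by (rule Poly_Mapping.keys_add)
  then show ?thesis
    using assms by (subst (1 2 3) lin_ext_finite[of ?A]) (auto simp: lookup_add sum.distrib)
qed

lemma single_mult_term:
  fixes a b :: "'r::comm_ring mpoly"
  shows "Poly_Mapping.single S a \<star> Poly_Mapping.single T b =
    (if S \<inter> T = {} then Poly_Mapping.single (S \<union> T) (sg (of_nat (inversions S T)) (a * b)) else 0)"
  unfolding gmult_def by (subst lin_ext_single; simp)+

lemma gmult_add_left: "(w + w') \<star> u = w \<star> u + w' \<star> u" for u :: "'r::comm_ring grass"
  unfolding gmult_def
  by (rule lin_ext_add)
    (auto simp: lin_ext_def distrib_right sg_add single_add simp flip: sum.distrib
      intro!: sum.cong sum.neutral)

lemma gmult_add_right: "w \<star> (u + u') = w \<star> u + w \<star> u'" for u :: "'r::comm_ring grass"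
proof -
  have *: "lin_ext (\<lambda>T b. if S \<inter> T = {}
       then Poly_Mapping.single (S \<union> T) (sg (of_nat (inversions S T)) (a * b)) else 0) (u + u') =
     lin_ext (\<lambda>T b. if S \<inter> T = {}
       then Poly_Mapping.single (S \<union> T) (sg (of_nat (inversions S T)) (a * b)) else 0) u +
     lin_ext (\<lambda>T b. if S \<inter> T = {}
       then Poly_Mapping.single (S \<union> T) (sg (of_nat (inversions S T)) (a * b)) else 0) u'"
    for S and a :: "'r mpoly"
    by (rule lin_ext_add) (auto simp: distrib_left sg_add single_add)
  show ?thesis
    unfolding gmult_def * by (simp add: lin_ext_def sum.distrib)
qed

lemma gmult_zero [simp]: "0 \<star> u = 0" "u \<star> 0 = 0" for u :: "'r::comm_ring grass"
  by (simp_all add: gmult_def) (simp add: lin_ext_def)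

lemma lookup_gscale: "Poly_Mapping.lookup (gscale a w) S = a * Poly_Mapping.lookup w S"
  by (simp add: gscale_def Poly_Mapping.map.rep_eq when_def)

lemma gscale_single: "gscale a (Poly_Mapping.single S b) = Poly_Mapping.single S (a * b)"
  by (rule poly_mapping_eqI) (simp add: lookup_gscale lookup_single when_def)

lemma gscale_add: "gscale a (u + w) = gscale a u + gscale a w"
  by (rule poly_mapping_eqI) (simp add: lookup_gscale lookup_add distrib_left)

lemma gscale_zero [simp]: "gscale a 0 = 0"
  by (rule poly_mapping_eqI) (simp add: lookup_gscale)

lemma gscale_sg: "gscale a (sg p u) = sg p (gscale a u)"
  by (cases p; rule poly_mapping_eqI) (simp_all add: lookup_gscale)

lemma gscale_gscale: "gscale a (gscale b u) = gscale b (gscale a u)"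
  by (rule poly_mapping_eqI) (simp add: lookup_gscale algebra_simps)

lemma pconst_one_mult [simp]: "pconst 1 * (p :: 'r::{comm_ring,comm_monoid_mult} mpoly) = p"
proof (rule poly_mapping_eqI)
  fix k
  let ?s = "\<lambda>p :: 'r mpoly. (\<Sum>m \<in> Poly_Mapping.keys p. Poly_Mapping.single m (Poly_Mapping.lookup p m))"
  have p: "p = ?s p"
    by (rule poly_mapping_eqI) (auto simp: lookup_sum lookup_single when_def in_keys_iff)
  have "pconst 1 * ?s p = ?s p"
    by (simp add: pconst_def sum_distrib_left mult_single)
  then show "Poly_Mapping.lookup (pconst 1 * p) k = Poly_Mapping.lookup p k"
    using p by simp
qed

lemma mult_pconst_one [simp]: "(p :: 'r::{comm_ring,comm_monoid_mult} mpoly) * pconst 1 = p"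
  using pconst_one_mult[of p] by (simp only: mult.commute)

lemma Rx_zero: "0 \<in> Rx n"
  by (simp add: Rx_def)

lemma Rx_pconst: "pconst r \<in> Rx n"
  by (auto simp: Rx_def pconst_def)

lemma Rx_add: "a \<in> Rx n \<Longrightarrow> b \<in> Rx n \<Longrightarrow> a + b \<in> Rx n"
  using Poly_Mapping.keys_add[of a b] unfolding Rx_def by blast

lemma Rx_sg: "a \<in> Rx n \<Longrightarrow> sg p a \<in> Rx n" for a :: "'r::comm_ring mpoly"
  by (cases p) (simp_all add: Rx_def)

lemma Rx_mult:
  fixes a b :: "'r::comm_ring mpoly"
  assumes "a \<in> Rx n" "b \<in> Rx n"
  shows "a * b \<in> Rx n"
  unfolding Rx_def
proof (rule CollectI, rule ballI)
  fix m assume "m \<in> Poly_Mapping.keys (a * b)"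
  then obtain k l where "k \<in> Poly_Mapping.keys a" "l \<in> Poly_Mapping.keys b" "m = k + l"
    using keys_mult[of a b] by blast
  then show "Poly_Mapping.keys m \<subseteq> {..<n}"
    using assms Poly_Mapping.keys_add[of k l] unfolding Rx_def by blast
qed

lemma grass_alg_single: "S \<subseteq> V \<Longrightarrow> a \<in> Rx n \<Longrightarrow> Poly_Mapping.single S a \<in> grass_alg n V"
  by (auto simp: grass_alg_def)

lemma grass_alg_zero: "0 \<in> grass_alg n V"
  by (simp add: grass_alg_def)

lemma grass_alg_coeff: "w \<in> grass_alg n V \<Longrightarrow> Poly_Mapping.lookup w S \<in> Rx n"
  by (cases "S \<in> Poly_Mapping.keys w") (auto simp: grass_alg_def in_keys_iff Rx_zero)

lemma grass_algI:
  assumes "\<And>S. Poly_Mapping.lookup w S \<in> Rx n" "\<And>S. Poly_Mapping.lookup w S \<noteq> 0 \<Longrightarrow> S \<subseteq> V"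
  shows "w \<in> grass_alg n V"
  using assms by (auto simp: grass_alg_def in_keys_iff)

lemma grass_alg_support: "w \<in> grass_alg n V \<Longrightarrow> Poly_Mapping.lookup w S \<noteq> 0 \<Longrightarrow> S \<subseteq> V"
  by (auto simp: grass_alg_def in_keys_iff)

lemma grass_alg_add:
  assumes "u \<in> grass_alg n V" "w \<in> grass_alg n V"
  shows "u + w \<in> grass_alg n V"
proof (rule grass_algI)
  fix S
  show "Poly_Mapping.lookup (u + w) S \<in> Rx n"
    using assms by (simp add: lookup_add Rx_add grass_alg_coeff)
  assume "Poly_Mapping.lookup (u + w) S \<noteq> 0"
  then have "Poly_Mapping.lookup u S \<noteq> 0 \<or> Poly_Mapping.lookup w S \<noteq> 0"
    by (auto simp: lookup_add)
  then show "S \<subseteq> V"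
    using assms grass_alg_support by blast
qed

lemma grass_alg_gscale:
  assumes "a \<in> Rx n" "w \<in> grass_alg n V"
  shows "gscale a w \<in> grass_alg n V"
proof (rule grass_algI)
  fix S
  show "Poly_Mapping.lookup (gscale a w) S \<in> Rx n"
    using assms by (simp add: lookup_gscale Rx_mult grass_alg_coeff)
  assume "Poly_Mapping.lookup (gscale a w) S \<noteq> 0"
  then have "Poly_Mapping.lookup w S \<noteq> 0"
    by (auto simp: lookup_gscale)
  then show "S \<subseteq> V"
    using assms grass_alg_support by blast
qed

lemma grass_alg_sum: "(\<And>v. v \<in> A \<Longrightarrow> h v \<in> grass_alg n V) \<Longrightarrow> sum h A \<in> grass_alg n V"
  by (induction A rule: infinite_finite_induct) (auto intro: grass_alg_zero grass_alg_add)

lemma grass_alg_induct [consumes 1, case_names zero single add]: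
  fixes w :: "'r::comm_ring grass"
  assumes w: "w \<in> grass_alg n V"
    and "P 0" "\<And>S a. S \<subseteq> V \<Longrightarrow> a \<in> Rx n \<Longrightarrow> P (Poly_Mapping.single S a)"
    and "\<And>u w. P u \<Longrightarrow> P w \<Longrightarrow> P (u + w)"
  shows "P w"
proof -
  have "P (\<Sum>S\<in>A. Poly_Mapping.single S (Poly_Mapping.lookup w S))"
    if "finite A" "A \<subseteq> Poly_Mapping.keys w" for A
    using that by (induction A rule: finite_induct) (use assms in \<open>auto simp: grass_alg_def\<close>)
  moreover have "(\<Sum>S\<in>Poly_Mapping.keys w. Poly_Mapping.single S (Poly_Mapping.lookup w S)) = w"
    by (rule poly_mapping_eqI) (auto simp: lookup_sum lookup_single when_def in_keys_iff)
  ultimately show ?thesis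
    by (metis finite_keys order_refl)
qed

lemma gpart_single:
  "gpart p (Poly_Mapping.single S a) = (if of_nat (card S) = p then Poly_Mapping.single S a else 0)"
  unfolding gpart_def by (subst lin_ext_single) auto

lemma gpart_add: "gpart p (u + w) = gpart p u + gpart p w"
  unfolding gpart_def by (rule lin_ext_add) (auto simp: single_add)

lemma gpart_zero [simp]: "gpart p 0 = 0"
  by (simp add: gpart_def)

lemma gpart_sg: "gpart p (sg q w) = sg q (gpart p w)"
proof -
  have "gpart p (- w) = - gpart p w"
    using gpart_add[of p w "- w"] by (simp add: eq_neg_iff_add_eq_0 add.commute)
  then show ?thesis by (cases q) simp_all
qed

lemma lookup_gpart:
  "Poly_Mapping.lookup (gpart p w) S = (if of_nat (card S) = p then Poly_Mapping.lookup w S else 0)"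
proof -
  have "Poly_Mapping.lookup (gpart p w) S = (\<Sum>T \<in> Poly_Mapping.keys w.
      if T = S then (if of_nat (card S) = p then Poly_Mapping.lookup w S else 0) else 0)"
    unfolding gpart_def lin_ext_def lookup_sum
    by (intro sum.cong) (auto simp: lookup_single when_def)
  then show ?thesis
    by (simp add: in_keys_iff)
qed

text \<open>Removal of the variable \<open>v\<close> from the left\<close>

definition contract :: "gvar \<Rightarrow> 'r::comm_ring grass \<Rightarrow> 'r grass" where
  "contract v = lin_ext (\<lambda>S a.
     if v \<in> S then Poly_Mapping.single (S - {v}) (sg (of_nat (card {u \<in> S. u < v})) a) else 0)"

definition koszul_d :: "gvar set \<Rightarrow> (gvar \<Rightarrow> 'r::comm_ring mpoly) \<Rightarrow> 'r grass \<Rightarrow> 'r grass" where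
  "koszul_d V g w = (\<Sum>v\<in>V. gscale (g v) (contract v w))"

lemma contract_single:
  "contract v (Poly_Mapping.single S a) =
     (if v \<in> S then Poly_Mapping.single (S - {v}) (sg (of_nat (card {u \<in> S. u < v})) a) else 0)"
  unfolding contract_def by (subst lin_ext_single) auto

lemma contract_add: "contract v (u + w) = contract v u + contract v w"
  unfolding contract_def by (rule lin_ext_add) (auto simp: sg_add single_add)

lemma contract_zero [simp]: "contract v 0 = 0"
  by (simp add: contract_def)

lemma koszul_d_add: "koszul_d V g (u + w) = koszul_d V g u + koszul_d V g w"
  by (simp add: koszul_d_def contract_add gscale_add sum.distrib)

lemma koszul_d_zero [simp]: "koszul_d V g 0 = 0"
  by (simp add: koszul_d_def)

definition grade_inv :: "'r::comm_ring grass \<Rightarrow> 'r grass" where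
  "grade_inv w = gpart 0 w - gpart 1 w"

lemma grade_inv_add: "grade_inv (u + w) = grade_inv u + grade_inv w"
  by (simp add: grade_inv_def gpart_add)

lemma grade_inv_zero [simp]: "grade_inv 0 = 0"
  by (simp add: grade_inv_def)

lemma grade_inv_single:
  "grade_inv (Poly_Mapping.single S a) = Poly_Mapping.single S (sg (of_nat (card S)) a)"
  by (cases "of_nat (card S) :: bit") (simp_all add: grade_inv_def gpart_single single_uminus)

lemma grade_inv_hom:
  assumes "gpart p a = a"
  shows "grade_inv a = sg p a"
proof (rule poly_mapping_eqI)
  fix S
  have "Poly_Mapping.lookup a S = (if of_nat (card S) = p then Poly_Mapping.lookup a S else 0)"
    using lookup_gpart[of p a S] assms by simp
  then show "Poly_Mapping.lookup (grade_inv a) S = Poly_Mapping.lookup (sg p a) S"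
    by (cases p) (auto simp: grade_inv_def lookup_minus lookup_gpart split: if_splits)
qed

lemma gmult_uminus_left: "(- w) \<star> u = - (w \<star> u)" for u :: "'r::comm_ring grass"
  using gmult_add_left[of w "- w" u] by (simp add: eq_neg_iff_add_eq_0 add.commute)

lemma gmult_sg_left: "(sg p w) \<star> u = sg p (w \<star> u)" for u :: "'r::comm_ring grass"
  by (cases p) (simp_all add: gmult_uminus_left)

lemma finite_inversions:
  assumes "finite S" "finite T"
  shows "finite {(a, b). a \<in> S \<and> b \<in> T \<and> b < a}"
  by (rule finite_subset[of _ "S \<times> T"]) (use assms in auto)

lemma inversions_left:
  fixes v :: gvar
  assumes "finite S" "finite T" "v \<in> S"
  shows "inversions S T = inversions (S - {v}) T + card {u \<in> T. u < v}"
proof -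
  have "{(a, b). a \<in> S \<and> b \<in> T \<and> b < a} =
      {(a, b). a \<in> S - {v} \<and> b \<in> T \<and> b < a} \<union> Pair v ` {u \<in> T. u < v}"
    using assms by auto
  moreover have "card (Pair v ` {u \<in> T. u < v}) = card {u \<in> T. u < v}"
    by (rule card_image) (auto simp: inj_on_def)
  moreover have "{(a, b). a \<in> S - {v} \<and> b \<in> T \<and> b < a} \<inter> Pair v ` {u \<in> T. u < v} = {}"
    by auto
  ultimately show ?thesis
    unfolding inversions_def
    using card_Un_disjoint[OF finite_inversions[of "S - {v}" T]
        finite_imageI[of "{u \<in> T. u < v}" "Pair v"]] assms by simp
qed

lemma inversions_right:
  fixes v :: gvar
  assumes "finite S" "finite T" "v \<in> T"
  shows "inversions S T = inversions S (T - {v}) + card {u \<in> S. v < u}"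
proof -
  have "{(a, b). a \<in> S \<and> b \<in> T \<and> b < a} =
      {(a, b). a \<in> S \<and> b \<in> T - {v} \<and> b < a} \<union> (\<lambda>u. (u, v)) ` {u \<in> S. v < u}"
    using assms by auto
  moreover have "card ((\<lambda>u. (u, v)) ` {u \<in> S. v < u}) = card {u \<in> S. v < u}"
    by (rule card_image) (auto simp: inj_on_def)
  moreover have "{(a, b). a \<in> S \<and> b \<in> T - {v} \<and> b < a} \<inter> (\<lambda>u. (u, v)) ` {u \<in> S. v < u} = {}"
    by auto
  ultimately show ?thesis
    unfolding inversions_def
    using card_Un_disjoint[OF finite_inversions[of S "T - {v}"]
        finite_imageI[of "{u \<in> S. v < u}" "\<lambda>u. (u, v)"]] assms by simp
qed

lemma card_split:
  fixes v :: gvar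
  assumes "finite S"
  shows "card (S - {v}) = card {u \<in> S. u < v} + card {u \<in> S. v < u}"
proof -
  have "S - {v} = {u \<in> S. u < v} \<union> {u \<in> S. v < u}"
    by auto
  moreover have "{u \<in> S. u < v} \<inter> {u \<in> S. v < u} = {}"
    by auto
  moreover have "finite {u \<in> S. u < v}" "finite {u \<in> S. v < u}"
    using assms by simp_all
  ultimately show ?thesis
    by (simp only: card_Un_disjoint)
qed

lemma bit_parities:
  fixes i p q r :: bit
  shows "(p + q) + (i + q) = i + p"
    and "(p + q) + (i + r) = (p + r) + (i + q)"
    and "(i + r) + p = 1 + ((1 + (p + r)) + ((i + q) + q))"
  by (cases i; cases p; cases q; cases r; simp)+

lemma contract_leibniz_single:
  fixes a b :: "'r::comm_ring mpoly"
  assumes fin: "finite S" "finite T"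
  shows "contract v (Poly_Mapping.single S a \<star> Poly_Mapping.single T b) =
     contract v (Poly_Mapping.single S a) \<star> Poly_Mapping.single T b +
     grade_inv (Poly_Mapping.single S a) \<star> contract v (Poly_Mapping.single T b)"
proof -
  let ?pS = "card {u \<in> S. u < v}" and ?pT = "card {u \<in> T. u < v}"
  note simps = single_mult_term contract_single grade_inv_single sg_mult_left sg_mult_right sg_sg
  have U: "card {u \<in> S \<union> T. u < v} = ?pS + ?pT" if "S \<inter> T = {}"
  proof -
    have "{u \<in> S \<union> T. u < v} = {u \<in> S. u < v} \<union> {u \<in> T. u < v}"
      "{u \<in> S. u < v} \<inter> {u \<in> T. u < v} = {}"
      using that by auto
    moreover have "finite {u \<in> S. u < v}" "finite {u \<in> T. u < v}"
      using fin by simp_all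
    ultimately show ?thesis
      by (simp only: card_Un_disjoint)
  qed
  consider (none) "S \<inter> T = {}" "v \<notin> S" "v \<notin> T" | (left) "S \<inter> T = {}" "v \<in> S"
    | (right) "S \<inter> T = {}" "v \<in> T" | (both) "S \<inter> T = {v}" | (other) u where "u \<in> S \<inter> T" "u \<noteq> v"
    by blast
  then show ?thesis
  proof cases
    case none
    then show ?thesis by (simp add: simps)
  next
    case left
    have v: "v \<notin> T" "(S - {v}) \<inter> T = {}" "S \<union> T - {v} = (S - {v}) \<union> T"
      using left by auto
    let ?A = "of_nat (card {u \<in> S \<union> T. u < v}) + of_nat (inversions S T) :: bit"
    let ?B = "of_nat (inversions (S - {v}) T) + of_nat ?pS :: bit"
    have l: "contract v (Poly_Mapping.single S a \<star> Poly_Mapping.single T b) =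
        Poly_Mapping.single ((S - {v}) \<union> T) (sg ?A (a * b))"
      using left v(3) by (simp only: simps if_True Un_iff simp_thms)
    have r: "contract v (Poly_Mapping.single S a) \<star> Poly_Mapping.single T b +
        grade_inv (Poly_Mapping.single S a) \<star> contract v (Poly_Mapping.single T b) =
        Poly_Mapping.single ((S - {v}) \<union> T) (sg ?B (a * b))"
      using left v(1,2) by (simp only: simps if_True if_False simp_thms gmult_zero add_0_right)
    have "?A = ?B"
      unfolding U[OF left(1)] inversions_left[OF fin left(2)] of_nat_add by (rule bit_parities)
    then show ?thesis
      unfolding l r by (simp only:)
  next
    case right
    have v: "v \<notin> S" "S \<inter> (T - {v}) = {}" "S \<union> T - {v} = S \<union> (T - {v})" "S - {v} = S"
      using right by auto
    let ?A = "of_nat (card {u \<in> S \<union> T. u < v}) + of_nat (inversions S T) :: bit"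
    let ?B = "of_nat (card S) + (of_nat (inversions S (T - {v})) + of_nat ?pT) :: bit"
    have l: "contract v (Poly_Mapping.single S a \<star> Poly_Mapping.single T b) =
        Poly_Mapping.single (S \<union> (T - {v})) (sg ?A (a * b))"
      using right v(3) by (simp only: simps if_True Un_iff simp_thms)
    have r: "contract v (Poly_Mapping.single S a) \<star> Poly_Mapping.single T b +
        grade_inv (Poly_Mapping.single S a) \<star> contract v (Poly_Mapping.single T b) =
        Poly_Mapping.single (S \<union> (T - {v})) (sg ?B (a * b))"
      using right v(1,2)
      by (simp only: simps if_True if_False simp_thms gmult_zero add_0_left ac_simps)
    have c: "card S = ?pS + card {u \<in> S. v < u}"
      using card_split[OF fin(1), of v] v(4) by (simp only:)
    have "?A = ?B"
      unfolding U[OF right(1)] inversions_right[OF fin right(2)] c of_nat_add by (rule bit_parities)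
    then show ?thesis
      unfolding l r by (simp only:)
  next
    case both
    have v: "v \<in> S" "v \<in> T" "(S - {v}) \<inter> T = {}" "S \<inter> (T - {v}) = {}"
      "S \<union> (T - {v}) = (S - {v}) \<union> T" "S \<inter> T \<noteq> {}"
      using both by auto
    have c: "card S = Suc (?pS + card {u \<in> S. v < u})"
      using card_split[OF fin(1), of v] v fin by (metis card_Suc_Diff1)
    have e: "{u \<in> T - {v}. u < v} = {u \<in> T. u < v}" "{u \<in> S - {v}. v < u} = {u \<in> S. v < u}"
      by auto
    have i: "inversions S (T - {v}) = inversions (S - {v}) (T - {v}) + ?pT"
      using inversions_left[OF fin(1) _ v(1), of "T - {v}"] fin e by simp
    have j: "inversions (S - {v}) T = inversions (S - {v}) (T - {v}) + card {u \<in> S. v < u}"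
      using inversions_right[OF _ fin(2) v(2), of "S - {v}"] fin e by simp
    let ?A = "of_nat (inversions (S - {v}) T) + of_nat ?pS :: bit"
    let ?B = "of_nat (card S) + (of_nat (inversions S (T - {v})) + of_nat ?pT) :: bit"
    have l: "contract v (Poly_Mapping.single S a) \<star> Poly_Mapping.single T b =
        Poly_Mapping.single ((S - {v}) \<union> T) (sg ?A (a * b))"
      using v(1,3) by (simp only: simps if_True simp_thms)
    have r: "grade_inv (Poly_Mapping.single S a) \<star> contract v (Poly_Mapping.single T b) =
        Poly_Mapping.single ((S - {v}) \<union> T) (sg ?B (a * b))"
      using v(2,4,5) by (simp only: simps if_True simp_thms ac_simps)
    have z: "contract v (Poly_Mapping.single S a \<star> Poly_Mapping.single T b) = 0"
      using v(6) by (simp only: simps if_False contract_zero)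
    have "?A = 1 + ?B"
      unfolding i j c of_nat_add of_nat_Suc by (rule bit_parities)
    then have "sg ?A (a * b) + sg ?B (a * b) = 0"
      by (simp only: sg_succ_add)
    then show ?thesis
      unfolding l r z by (simp only: single_zero flip: single_add)
  next
    case other
    then have "u \<in> (S - {v}) \<inter> T" "u \<in> S \<inter> (T - {v})" "u \<in> S \<inter> T"
      by auto
    then have "(S - {v}) \<inter> T \<noteq> {}" "S \<inter> (T - {v}) \<noteq> {}" "S \<inter> T \<noteq> {}"
      by blast+
    then show ?thesis
      by (simp add: simps)
  qed
qed

lemma contract_leibniz:
  fixes a b :: "'r::comm_ring grass"
  assumes "finite V" "a \<in> grass_alg n V" "b \<in> grass_alg n V"
  shows "contract v (a \<star> b) = contract v a \<star> b + grade_inv a \<star> contract v b"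
  using assms(2)
proof (induction a rule: grass_alg_induct)
  case (single S c)
  show ?case
    using assms(3)
  proof (induction b rule: grass_alg_induct)
    case (single T c')
    show ?case
      using \<open>S \<subseteq> V\<close> \<open>T \<subseteq> V\<close> assms(1) by (intro contract_leibniz_single) (auto intro: finite_subset)
  qed (simp_all add: gmult_add_right contract_add algebra_simps)
qed (simp_all add: gmult_add_left contract_add grade_inv_add algebra_simps)

lemma gscale_mult_left:
  fixes a b :: "'r::comm_ring grass"
  assumes "a \<in> grass_alg n V" "b \<in> grass_alg n V"
  shows "gscale c (a \<star> b) = gscale c a \<star> b"
  using assms(1)
proof (induction a rule: grass_alg_induct)
  case (single S k)
  show ?case
    using assms(2)
    by (induction b rule: grass_alg_induct)
      (simp_all add: single_mult_term gscale_single sg_mult_right gmult_add_right gscale_add ac_simps)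
qed (simp_all add: gmult_add_left gscale_add)

lemma gscale_mult_right:
  fixes a b :: "'r::comm_ring grass"
  assumes "a \<in> grass_alg n V" "b \<in> grass_alg n V"
  shows "gscale c (a \<star> b) = a \<star> gscale c b"
  using assms(1)
proof (induction a rule: grass_alg_induct)
  case (single S k)
  show ?case
    using assms(2)
    by (induction b rule: grass_alg_induct)
      (simp_all add: single_mult_term gscale_single sg_mult_right gmult_add_right gscale_add ac_simps)
qed (simp_all add: gmult_add_left gscale_add)

lemma contract_closed: "w \<in> grass_alg n V \<Longrightarrow> contract v w \<in> grass_alg n V"
  by (induction w rule: grass_alg_induct)
    (auto simp: contract_single contract_add intro!: grass_alg_single grass_alg_zero grass_alg_add Rx_sg)

lemma contract_gscale:
  "w \<in> grass_alg n V \<Longrightarrow> contract v (gscale c w) = gscale c (contract v w)"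
  by (induction w rule: grass_alg_induct)
    (auto simp: contract_single contract_add gscale_single gscale_add sg_mult_right)

lemma contract_gpart:
  assumes "finite V"
  shows "w \<in> grass_alg n V \<Longrightarrow> gpart (p + 1) (contract v w) = contract v (gpart p w)"
proof (induction w rule: grass_alg_induct)
  case (single S a)
  have "of_nat (card S) = (1 + of_nat (card (S - {v})) :: bit)" if "v \<in> S"
    using that single assms card_Suc_Diff1[of S v] by (metis of_nat_Suc finite_subset)
  moreover have "(x = p + 1) \<longleftrightarrow> (1 + x = p)" for x :: bit
    by (cases x; cases p) simp_all
  ultimately show ?case
    by (auto simp: contract_single gpart_single)
qed (simp_all add: contract_add gpart_add)

lemma gpart_gscale: "gpart p (gscale c w) = gscale c (gpart p w)"
  by (rule poly_mapping_eqI) (simp add: lookup_gpart lookup_gscale)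

lemma gpart_sum: "gpart p (sum h A) = (\<Sum>v\<in>A. gpart p (h v))"
  by (induction A rule: infinite_finite_induct) (simp_all add: gpart_add)

lemma gmult_sum_left: "sum h A \<star> u = (\<Sum>v\<in>A. h v \<star> u)"
  by (induction A rule: infinite_finite_induct) (simp_all add: gmult_add_left)

lemma gmult_sum_right: "u \<star> sum h A = (\<Sum>v\<in>A. u \<star> h v)"
  by (induction A rule: infinite_finite_induct) (simp_all add: gmult_add_right)

lemma grass_alg_uminus: "w \<in> grass_alg n V \<Longrightarrow> - w \<in> grass_alg n V" for w :: "'r::comm_ring grass"
  by (simp add: grass_alg_def Rx_def)

lemma koszul_differential_exists:
  fixes g :: "gvar \<Rightarrow> 'r::{comm_ring,comm_monoid_mult} mpoly"
  assumes V: "finite V" and g: "\<forall>v\<in>V. g v \<in> Rx n"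
  shows "koszul_differential n V g (koszul_d V g)"
proof -
  let ?d = "koszul_d V g"
  have closed: "?d w \<in> grass_alg n V" if "w \<in> grass_alg n V" for w
    unfolding koszul_d_def using that g
    by (intro grass_alg_sum grass_alg_gscale contract_closed) auto
  have scale: "?d (gscale c w) = gscale c (?d w)" if "w \<in> grass_alg n V" for c w
  proof -
    have "gscale c (sum h A) = (\<Sum>v\<in>A. gscale c (h v))" for h :: "gvar \<Rightarrow> 'r grass" and A
      by (induction A rule: infinite_finite_induct) (simp_all add: gscale_add)
    then show ?thesis
      by (simp add: koszul_d_def contract_gscale[OF that] gscale_gscale[of c])
  qed
  have odd: "gpart (1 + q) (?d w) = ?d w" if "w \<in> grass_alg n V" "gpart q w = w" for q w
    using contract_gpart[OF V that(1), of q] that(2)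
    by (simp add: koszul_d_def gpart_sum gpart_gscale add.commute)
  have leibniz: "?d (a \<star> b) = ?d a \<star> b + sg p (a \<star> ?d b)"
    if ab: "a \<in> grass_alg n V" "b \<in> grass_alg n V" and p: "gpart p a = a" for a b p
  proof -
    have inv: "grade_inv a \<in> grass_alg n V"
      using ab grade_inv_hom[OF p] by (cases p) (auto intro: grass_alg_uminus)
    have "?d (a \<star> b) = (\<Sum>v\<in>V. gscale (g v) (contract v a \<star> b) + gscale (g v) (grade_inv a \<star> contract v b))"
      by (simp add: koszul_d_def contract_leibniz[OF V ab] gscale_add)
    also have "\<dots> = (\<Sum>v\<in>V. gscale (g v) (contract v a) \<star> b + grade_inv a \<star> gscale (g v) (contract v b))"
      using gscale_mult_left[OF contract_closed[OF ab(1)] ab(2)]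
        gscale_mult_right[OF inv contract_closed[OF ab(2)]] by simp
    also have "\<dots> = ?d a \<star> b + grade_inv a \<star> ?d b"
      by (simp add: koszul_d_def sum.distrib gmult_sum_left gmult_sum_right)
    finally show ?thesis
      by (simp add: grade_inv_hom[OF p] gmult_sg_left)
  qed
  have gen: "?d (gen v) = gscale (g v) gone" if "v \<in> V" for v
  proof -
    have "{u. u = v \<and> u < v} = {}"
      by auto
    then have "contract u (gen v :: 'r grass) = (if u = v then gone else 0)" for u
      by (simp add: gmono_def contract_single Collect_conv_if)
    then have "?d (gen v) = (\<Sum>u\<in>V. if u = v then gscale (g v) gone else 0)"
      unfolding koszul_d_def by (intro sum.cong) simp_all
    then show ?thesis
      using that V by simp
  qed
  show ?thesis
    unfolding koszul_differential_def graded_map_def hom_elems_def grass_cplx_def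
    using closed scale odd leibniz gen by (simp add: koszul_d_add)
qed

lemma gmono_mult:
  "S \<inter> T = {} \<Longrightarrow> gmono S \<star> gmono T = sg (of_nat (inversions S T)) (gmono (S \<union> T))"
  by (simp add: gmono_def single_mult_term single_sg)

lemma param_ext_gmono:
  fixes \<phi> :: "'r::{comm_ring,comm_monoid_mult} grass \<Rightarrow> 'r mpoly"
  assumes "S \<inter> V = {}" "T \<subseteq> V"
  shows "param_ext V p \<phi> (gmono S \<star> gmono T) =
     sg (p * of_nat (card S)) (gscale (\<phi> (gmono T)) (gmono S))"
proof -
  have *: "S \<inter> T = {}" "S \<union> T - V = S" "(S \<union> T) \<inter> V = T"
    using assms by auto
  let ?i = "of_nat (inversions S T) :: bit" and ?q = "p * of_nat (card S)"
  have "gmono S \<star> gmono T = (Poly_Mapping.single (S \<union> T) (sg ?i (pconst 1)) :: 'r grass)"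
    using *(1) unfolding gmono_def single_mult_term pconst_one_mult by (simp only: if_True simp_thms)
  then have "param_ext V p \<phi> (gmono S \<star> gmono T) =
      Poly_Mapping.single S (sg (?i + ?q) (sg ?i (pconst 1) * \<phi> (gmono T)))"
    unfolding param_ext_def by (simp only:) (subst lin_ext_single; simp only: * mult_zero_left sg_zero single_zero)
  also have "\<dots> = Poly_Mapping.single S (sg (?i + ?q + ?i) (\<phi> (gmono T)))"
    by (simp only: sg_mult_left sg_sg pconst_one_mult)
  also have "?i + ?q + ?i = ?q"
    by (cases ?i; cases ?q) simp_all
  also have "Poly_Mapping.single S (sg ?q (\<phi> (gmono T))) = sg ?q (gscale (\<phi> (gmono T)) (gmono S))"
    by (simp only: gmono_def gscale_single mult_pconst_one single_sg)
  finally show ?thesis .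
qed

lemma foldr_gen:
  "sorted xs \<Longrightarrow> distinct xs \<Longrightarrow>
     foldr (\<lambda>v w. gen v \<star> w) xs gone = (gmono (set xs) :: 'r::{comm_ring,comm_monoid_mult} grass)"
proof (induction xs)
  case (Cons v xs)
  have "\<not> b < v" if "b \<in> set xs" for b
    using Cons.prems(1) that leD[of v b] by simp
  then have "{(a, b). a \<in> {v} \<and> b \<in> set xs \<and> b < a} = {}"
    by blast
  then have "inversions {v} (set xs) = 0"
    unfolding inversions_def by (simp only: card.empty)
  then show ?case
    using Cons gmono_mult[of "{v}" "set xs"] by simp
qed simp

lemma det_fun_gmono:
  "det_fun V (gmono S :: 'r::{comm_ring,comm_monoid_mult} grass) = (if S = V then pconst 1 else 0)"
  by (simp add: det_fun_def gmono_def lookup_single when_def)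

end

theory Submission
  imports Defs
begin

text \<open>
  All four maps are built from two: the functional \<open>det_op V\<close>, which sends a product \<open>u \<star> w\<close> of
  \<open>u \<in> \<Lambda>(U)\<close> and \<open>w \<in> \<Lambda>(V)\<close> to \<open>\<plusminus>det(w) u\<close>, and the renaming of variables.

  The functional \<open>det_op V\<close> commutes with \<open>\<partial>\<close> up to the sign of its parity because the differential
  lowers the number of variables. By the Leibniz rule \<open>\<partial>(u \<star> w)\<close> consists of \<open>\<partial>u \<star> w\<close> and
  \<open>\<plusminus>u \<star> \<partial>w\<close>; no monomial of \<open>\<partial>w\<close> can be the product of all variables of \<open>V\<close>, so the second term is
  sent to 0, and the first one to \<open>\<plusminus>det(w) \<partial>u\<close>
  (\<open>det_op_mult\<close>, \<open>det_op_complex_morphism\<close>).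

  A renaming that is increasing on the variables involved maps the monomial of a set to the monomial
  of the image set without any sign, so it commutes with every operation that is defined through the
  order of the variables. It is a chain map as soon as it preserves the values of \<open>\<partial>\<close> on the variables
  (\<open>gsubst_complex_morphism\<close>), and it carries \<open>det_op V\<close> to the functional of the renamed variables
  (\<open>det_op_gsubst\<close>). All substitutions between the collections \<open>f, f', F, F'\<close> which occur are of
  this kind. This gives both vanishing brackets, and the maps (a) and (c).

  The maps (b) and (d) are dual to morphisms between Grassmann algebras. Dualizing with the sign
  \<open>(-1)\<^sup>p\<^sup>q\<close> sends a complex morphism to a complex morphism (\<open>pull_complex_morphism\<close>). Reading a
  functional in primed variables means composing it with the renaming back, so that the
  substitution \<open>exp\<close> in (b) and (d) cancels against it: what remains to be dualized is \<open>det_op\<close> in (b)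
  and the inclusion \<open>\<Lambda>(f) \<subseteq> \<Lambda>(f, F)\<close> in (d).
\<close>

section \<open>The grading and the twist\<close>

lemma grass_alg_mono: "V \<subseteq> W \<Longrightarrow> w \<in> grass_alg n V \<Longrightarrow> w \<in> grass_alg n W"
  unfolding grass_alg_def by blast

lemma grass_alg_sg: "w \<in> grass_alg n V \<Longrightarrow> sg p w \<in> grass_alg n V" for w :: "'r::comm_ring grass"
  by (cases p) (simp_all add: grass_alg_uminus)

lemma grass_alg_gpart: "w \<in> grass_alg n V \<Longrightarrow> gpart p w \<in> grass_alg n V" for w :: "'r::comm_ring grass"
  by (rule grass_algI) (auto simp: lookup_gpart Rx_zero grass_alg_coeff dest: grass_alg_support split: if_splits)

lemma gpart_gpart: "gpart p (gpart q w) = (if p = q then gpart p w else 0)"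
  by (rule poly_mapping_eqI) (simp add: lookup_gpart)

lemma gpart_sum_eq: "gpart 0 w + gpart 1 w = w"
  by (rule poly_mapping_eqI) (simp add: lookup_gpart lookup_add)

lemma gscale_add_left: "gscale (a + b) w = gscale a w + gscale b w"
  by (rule poly_mapping_eqI) (simp add: lookup_gscale lookup_add distrib_right)

lemma gscale_zero_left [simp]: "gscale 0 w = 0"
  by (rule poly_mapping_eqI) (simp add: lookup_gscale)

lemma gscale_pconst_one [simp]: "gscale (pconst 1) w = w"
  for w :: "'r::{comm_ring,comm_monoid_mult} grass"
  by (rule poly_mapping_eqI) (simp add: lookup_gscale)

lemma gscale_sg_one: "gscale (sg p (pconst 1)) w = sg p w"
  for w :: "'r::{comm_ring,comm_monoid_mult} grass"
  by (cases p; rule poly_mapping_eqI) (simp_all add: lookup_gscale)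

lemma gscale_uminus_sg_one: "gscale (- sg p (pconst 1)) w = - sg p w"
  for w :: "'r::{comm_ring,comm_monoid_mult} grass"
  by (cases p; rule poly_mapping_eqI) (simp_all add: lookup_gscale)

text \<open>
  \<open>w \<mapsto> (-1)\<^sup>q\<^sup>|\<^sup>w\<^sup>| w\<close>, extended additively. Koszul signs then become an operator that
  applies to elements with components of both parities and can be moved past other maps.
\<close>

definition twist :: "bit \<Rightarrow> 'r::comm_ring grass \<Rightarrow> 'r grass" where
  "twist q w = gpart 0 w + sg q (gpart 1 w)"

lemma twist_add: "twist q (u + w) = twist q u + twist q w"
  by (simp add: twist_def gpart_add sg_add)

lemma twist_zero_elem [simp]: "twist q 0 = 0"
  by (simp add: twist_def)

lemma twist_zero [simp]: "twist 0 w = w"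
  by (simp add: twist_def gpart_sum_eq)

lemma twist_single: "twist q (Poly_Mapping.single S a) = Poly_Mapping.single S (sg (q * of_nat (card S)) a)"
  by (cases "of_nat (card S) :: bit") (simp_all add: twist_def gpart_single single_sg)

lemma twist_gscale: "twist q (gscale a w) = gscale a (twist q w)"
  by (simp add: twist_def gpart_gscale gscale_add gscale_sg)

lemma bit_double: "p + p = 0" for p :: bit
  by (cases p) simp_all

lemma twist_sg: "twist q (sg r w) = sg r (twist q w)"
  by (simp only: twist_def gpart_sg sg_add sg_sg add.commute[of q r])

lemma twist_gpart: "twist q (gpart p w) = gpart p (twist q w)"
  by (cases p) (simp_all add: twist_def gpart_gpart gpart_add gpart_sg)

lemma twist_closed: "w \<in> grass_alg n V \<Longrightarrow> twist q w \<in> grass_alg n V"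
  unfolding twist_def by (intro grass_alg_add grass_alg_sg grass_alg_gpart)

lemma twist_twist_comm: "twist p (twist q w) = twist q (twist p w)"
  by (cases p; cases q) simp_all

section \<open>Graded maps between Grassmann algebras\<close>

lemma grass_cplx_simps [simp]:
  "car (grass_cplx n V d) = grass_alg n V" "czero (grass_cplx n V d) = 0"
  "cadd (grass_cplx n V d) = (+)" "csmul (grass_cplx n V d) = gscale"
  "cpart (grass_cplx n V d) = gpart" "cdiff (grass_cplx n V d) = d"
  by (simp_all add: grass_cplx_def)

context
  fixes n :: nat and p :: bit and V W :: "gvar set"
    and d e :: "'r::{comm_ring,comm_monoid_mult} grass \<Rightarrow> 'r grass" and \<phi> :: "'r grass \<Rightarrow> 'r grass"
  assumes gm: "graded_map n p (grass_cplx n V d) (grass_cplx n W e) \<phi>"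
begin

lemma graded_map_closed: "w \<in> grass_alg n V \<Longrightarrow> \<phi> w \<in> grass_alg n W"
  using gm by (simp add: graded_map_def)

lemma graded_map_add: "u \<in> grass_alg n V \<Longrightarrow> w \<in> grass_alg n V \<Longrightarrow> \<phi> (u + w) = \<phi> u + \<phi> w"
  using gm by (simp add: graded_map_def)

lemma graded_map_gscale: "a \<in> Rx n \<Longrightarrow> w \<in> grass_alg n V \<Longrightarrow> \<phi> (gscale a w) = gscale a (\<phi> w)"
  using gm by (simp add: graded_map_def)

lemma graded_map_sg: "w \<in> grass_alg n V \<Longrightarrow> \<phi> (sg q w) = sg q (\<phi> w)"
  using graded_map_gscale[of "sg q (pconst 1)" w] by (simp add: gscale_sg_one Rx_sg Rx_pconst)

lemma graded_map_zero: "\<phi> 0 = 0"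
  using graded_map_add[of 0 0] grass_alg_zero[of n V] by simp

text \<open>
  Preserving homogeneity, together with additivity, determines the map on each component: of the two
  components of \<open>w\<close>, exactly one is sent to parity \<open>p + q\<close>.
\<close>

lemma graded_map_gpart:
  assumes w: "w \<in> grass_alg n V"
  shows "\<phi> (gpart q w) = gpart (p + q) (\<phi> w)"
proof -
  have hom: "gpart (p + r) (\<phi> (gpart r w)) = \<phi> (gpart r w)" for r
    using gm w by (simp add: graded_map_def hom_elems_def grass_alg_gpart gpart_gpart)
  have other: "gpart (p + q) (\<phi> (gpart r w)) = (if q = r then \<phi> (gpart r w) else 0)" for r
    by (metis hom gpart_gpart add_left_cancel)
  have "\<phi> w = \<phi> (gpart 0 w) + \<phi> (gpart 1 w)"
    using graded_map_add[of "gpart 0 w" "gpart 1 w"] w by (simp add: grass_alg_gpart gpart_sum_eq)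
  then have "gpart (p + q) (\<phi> w) = gpart (p + q) (\<phi> (gpart 0 w)) + gpart (p + q) (\<phi> (gpart 1 w))"
    by (simp only: gpart_add)
  then show ?thesis
    unfolding other by (cases q) simp_all
qed

text \<open>
  This is where all signs in the later proofs come from: moving a map of parity \<open>p\<close> past the sign
  \<open>(-1)\<^sup>q\<^sup>|\<^sup>w\<^sup>|\<close> shifts \<open>|w|\<close> by \<open>p\<close>, and so costs \<open>(-1)\<^sup>p\<^sup>q\<close>.
\<close>

lemma graded_map_twist:
  assumes w: "w \<in> grass_alg n V"
  shows "\<phi> (twist q w) = sg (p * q) (twist q (\<phi> w))"
proof -
  have "\<phi> (twist q w) = gpart p (\<phi> w) + sg q (gpart (p + 1) (\<phi> w))"
    using w graded_map_gpart[OF w, of 0] graded_map_gpart[OF w, of 1]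
    by (simp add: twist_def graded_map_add graded_map_sg grass_alg_gpart grass_alg_sg)
  also have "\<dots> = sg (p * q) (twist q (\<phi> w))"
    by (cases p; cases q) (simp_all add: twist_def add.commute)
  finally show ?thesis .
qed

end

lemma graded_mapI:
  assumes "\<And>w. w \<in> grass_alg n V \<Longrightarrow> \<phi> w \<in> grass_alg n W"
    and "\<And>u w. u \<in> grass_alg n V \<Longrightarrow> w \<in> grass_alg n V \<Longrightarrow> \<phi> (u + w) = \<phi> u + \<phi> w"
    and "\<And>a w. a \<in> Rx n \<Longrightarrow> w \<in> grass_alg n V \<Longrightarrow> \<phi> (gscale a w) = gscale a (\<phi> w)"
    and "\<And>q w. w \<in> grass_alg n V \<Longrightarrow> gpart (p + q) (\<phi> w) = \<phi> (gpart q w)"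
  shows "graded_map n p (grass_cplx n V d) (grass_cplx n W e) \<phi>"
  unfolding graded_map_def hom_elems_def using assms by simp

lemma complex_morphism_grass_iff:
  "complex_morphism n p (grass_cplx n V d) (grass_cplx n W e) \<phi> \<longleftrightarrow>
     graded_map n p (grass_cplx n V d) (grass_cplx n W e) \<phi> \<and>
     (\<forall>w \<in> grass_alg n V. e (\<phi> w) = sg p (\<phi> (d w)))"
  by (simp add: complex_morphism_def bracket_def gscale_uminus_sg_one)

lemma complex_morphism_comp:
  assumes \<phi>: "complex_morphism n p (grass_cplx n U d) (grass_cplx n V e) \<phi>"
    and \<psi>: "complex_morphism n q (grass_cplx n V e) (grass_cplx n W h) \<psi>"
    and d: "\<And>w. w \<in> grass_alg n U \<Longrightarrow> d w \<in> grass_alg n U"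
  shows "complex_morphism n (p + q) (grass_cplx n U d) (grass_cplx n W h) (\<lambda>w. \<psi> (\<phi> w))"
proof -
  note g = \<phi>[unfolded complex_morphism_grass_iff, THEN conjunct1]
    \<psi>[unfolded complex_morphism_grass_iff, THEN conjunct1]
  note closed = graded_map_closed[OF g(1)]
  have "gpart (p + q + r) (\<psi> (\<phi> w)) = \<psi> (\<phi> (gpart r w))" if "w \<in> grass_alg n U" for r w
    unfolding graded_map_gpart[OF g(1) that] graded_map_gpart[OF g(2) closed[OF that]]
    by (simp only: ac_simps)
  moreover have "h (\<psi> (\<phi> w)) = sg (p + q) (\<psi> (\<phi> (d w)))" if w: "w \<in> grass_alg n U" for w
  proof -
    have "h (\<psi> (\<phi> w)) = sg q (\<psi> (sg p (\<phi> (d w))))"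
      using \<phi> \<psi> w closed[OF w] by (simp add: complex_morphism_grass_iff)
    also have "\<dots> = sg (p + q) (\<psi> (\<phi> (d w)))"
      by (simp only: graded_map_sg[OF g(2) closed[OF d[OF w]]] sg_sg add.commute)
    finally show ?thesis .
  qed
  ultimately show ?thesis
    unfolding complex_morphism_grass_iff
    by (auto intro!: graded_mapI
        simp: closed graded_map_closed[OF g(2)] graded_map_add[OF g(1)] graded_map_add[OF g(2)]
          graded_map_gscale[OF g(1)] graded_map_gscale[OF g(2)])
qed

lemma complex_morphism_cong:
  assumes \<phi>: "complex_morphism n p (grass_cplx n V d) (grass_cplx n W e) \<phi>"
    and d: "\<And>w. w \<in> grass_alg n V \<Longrightarrow> d w \<in> grass_alg n V"
    and eq: "\<And>w. w \<in> grass_alg n V \<Longrightarrow> \<psi> w = \<phi> w"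
  shows "complex_morphism n p (grass_cplx n V d) (grass_cplx n W e) \<psi>"
proof -
  note g = \<phi>[unfolded complex_morphism_grass_iff, THEN conjunct1]
  show ?thesis
    using \<phi> unfolding complex_morphism_grass_iff
    by (auto intro!: graded_mapI
        simp: eq d graded_map_closed[OF g] graded_map_add[OF g] graded_map_gscale[OF g]
          graded_map_gpart[OF g] grass_alg_add grass_alg_gscale grass_alg_gpart)
qed

text \<open>
  Maps that are additive only on the algebra require the summands in the last case to lie in it.
\<close>

lemma grass_alg_induct' [consumes 1, case_names zero single add]:
  fixes w :: "'r::comm_ring grass"
  assumes "w \<in> grass_alg n V" "P 0"
    and "\<And>S a. S \<subseteq> V \<Longrightarrow> a \<in> Rx n \<Longrightarrow> P (Poly_Mapping.single S a)"
    and "\<And>u w. u \<in> grass_alg n V \<Longrightarrow> w \<in> grass_alg n V \<Longrightarrow> P u \<Longrightarrow> P w \<Longrightarrow> P (u + w)"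
  shows "P w"
proof -
  have "P w \<and> w \<in> grass_alg n V"
    using assms(1) by (induction w rule: grass_alg_induct)
      (use assms in \<open>auto intro: grass_alg_zero grass_alg_single grass_alg_add\<close>)
  then show ?thesis ..
qed

section \<open>The Koszul differential on a subset of the variables\<close>

lemma koszul_differential_graded:
  "koszul_differential n V g d \<Longrightarrow> graded_map n 1 (grass_cplx n V d) (grass_cplx n V d) d"
  by (simp add: koszul_differential_def)

lemma gmono_closed: "S \<subseteq> V \<Longrightarrow> gmono S \<in> grass_alg n V"
  unfolding gmono_def by (intro grass_alg_single Rx_pconst)

lemma gmult_gone: "w \<in> grass_alg n V \<Longrightarrow> gone \<star> w = w"
  by (induction w rule: grass_alg_induct)
    (simp_all add: gmono_def single_mult_term inversions_def gmult_add_right)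

lemma gmult_closed:
  fixes a b :: "'r::comm_ring grass"
  assumes "a \<in> grass_alg n V" "b \<in> grass_alg n V"
  shows "a \<star> b \<in> grass_alg n V"
  using assms(1)
proof (induction a rule: grass_alg_induct)
  case (single S k)
  show ?case
    using assms(2)
  proof (induction b rule: grass_alg_induct)
    case (single T l)
    then show ?case
      using \<open>S \<subseteq> V\<close> \<open>k \<in> Rx n\<close>
      by (auto simp: single_mult_term intro!: grass_alg_single grass_alg_zero Rx_sg Rx_mult)
  qed (auto simp: gmult_add_right intro: grass_alg_zero grass_alg_add)
qed (auto simp: gmult_add_left intro: grass_alg_zero grass_alg_add)

lemma koszul_differential_leibniz:
  assumes "koszul_differential n V g d" "a \<in> grass_alg n V" "gpart p a = a" "b \<in> grass_alg n V"
  shows "d (a \<star> b) = d a \<star> b + sg p (a \<star> d b)"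
  using assms unfolding koszul_differential_def hom_elems_def by simp

text \<open>
  The Leibniz rule for \<open>1 = 1 \<star> 1\<close> reads \<open>\<partial>1 = \<partial>1 + \<partial>1\<close>.
\<close>

lemma koszul_differential_gone:
  fixes d :: "'r::{comm_ring,comm_monoid_mult} grass \<Rightarrow> 'r grass"
  assumes d: "koszul_differential n V g d"
  shows "d gone = 0"
proof -
  note gr = koszul_differential_graded[OF d]
  have one: "(gone :: 'r grass) \<in> grass_alg n V" and hom: "gpart 0 gone = (gone :: 'r grass)"
    by (simp add: gmono_closed) (simp add: gmono_def gpart_single)
  have "a \<star> gone = a" if "a \<in> grass_alg n V" for a :: "'r grass"
    using that by (induction a rule: grass_alg_induct)
      (simp_all add: gmono_def single_mult_term inversions_def gmult_add_left)
  then have "d gone = d gone + d gone"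
    using koszul_differential_leibniz[OF d one hom one] graded_map_closed[OF gr one] one
    by (simp add: gmult_gone[of _ n V])
  then show ?thesis
    by simp
qed

text \<open>
  Every monomial is, up to sign, obtained from 1 by multiplying with one variable at a time, and the
  Leibniz rule determines the differential of such a product. Hence the differential is given by the
  Koszul formula, which makes it computable on monomials.
\<close>

lemma koszul_differential_unique:
  fixes d d' :: "'r::{comm_ring,comm_monoid_mult} grass \<Rightarrow> 'r grass"
  assumes d: "koszul_differential n V g d" and d': "koszul_differential n V g d'"
    and V: "finite V" and w: "w \<in> grass_alg n V"
  shows "d w = d' w"
proof -
  note gr = koszul_differential_graded
  have mono: "d (gmono S) = d' (gmono S)" if "S \<subseteq> V" for S
    using finite_subset[OF that V] that
  proof (induction S rule: finite_induct)
    case empty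
    then show ?case
      using koszul_differential_gone d d' by metis
  next
    case (insert v S)
    let ?k = "of_nat (inversions {v} S) :: bit"
    have cl: "gen v \<in> grass_alg n V" "gmono S \<in> grass_alg n V"
      using insert.prems by (simp_all add: gmono_closed)
    have "gmono (insert v S) = sg ?k (gen v \<star> gmono S :: 'r grass)"
      using insert.hyps by (simp add: gmono_mult sg_sg)
    then have step: "e (gmono (insert v S)) = sg ?k (gscale (g v) gone \<star> gmono S - gen v \<star> e (gmono S))"
      if e: "koszul_differential n V g e" for e :: "'r grass \<Rightarrow> 'r grass"
    proof -
      have "e (gen v) = gscale (g v) gone"
        using e insert.prems by (simp add: koszul_differential_def)
      moreover have "gpart 1 (gen v) = (gen v :: 'r grass)"
        by (simp add: gmono_def gpart_single)
      ultimately have "e (gen v \<star> gmono S) = gscale (g v) gone \<star> gmono S - gen v \<star> e (gmono S)"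
        using koszul_differential_leibniz[OF e cl(1) _ cl(2), of 1] by simp
      then show ?thesis
        using \<open>gmono (insert v S) = _\<close> graded_map_sg[OF gr[OF e] gmult_closed[OF cl]] by simp
    qed
    show ?case
      unfolding step[OF d] step[OF d'] using insert by simp
  qed
  show ?thesis
    using w
  proof (induction w rule: grass_alg_induct')
    case zero
    show ?case
      by (simp add: graded_map_zero[OF gr[OF d]] graded_map_zero[OF gr[OF d']])
  next
    case (single S a)
    have "Poly_Mapping.single S a = gscale a (gmono S)"
      by (simp add: gmono_def gscale_single)
    then show ?case
      using single mono
      by (simp add: gmono_closed graded_map_gscale[OF gr[OF d]] graded_map_gscale[OF gr[OF d']])
  next
    case (add u w)
    then show ?case
      by (simp add: graded_map_add[OF gr[OF d]] graded_map_add[OF gr[OF d']])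
  qed
qed

lemma koszul_d_subset:
  fixes w :: "'r::comm_ring grass"
  assumes "finite V" "W \<subseteq> V" and w: "w \<in> grass_alg n W"
  shows "koszul_d V g w = koszul_d W g w"
proof -
  have "contract v w = 0" if "v \<notin> W" for v
    using w that by (induction w rule: grass_alg_induct) (auto simp: contract_single contract_add)
  then show ?thesis
    unfolding koszul_d_def using assms by (intro sum.mono_neutral_right) auto
qed

lemma koszul_differential_eq:
  fixes d :: "'r::{comm_ring,comm_monoid_mult} grass \<Rightarrow> 'r grass"
  assumes "koszul_differential n V g d" "finite V" "\<forall>v\<in>V. g v \<in> Rx n" "w \<in> grass_alg n V"
  shows "d w = koszul_d V g w"
  using assms koszul_differential_unique koszul_differential_exists by metis

text \<open>
  The smaller complexes carry the restrictions of one differential on all variables. The point is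
  that the restriction does not leave the subalgebra: in the Koszul formula, contraction with a
  variable outside \<open>W\<close> vanishes there.
\<close>

lemma koszul_differential_subset:
  fixes d :: "'r::{comm_ring,comm_monoid_mult} grass \<Rightarrow> 'r grass"
  assumes d: "koszul_differential n V g d" and V: "finite V" "\<forall>v\<in>V. g v \<in> Rx n" and W: "W \<subseteq> V"
  shows "koszul_differential n W g d"
proof -
  note gr = koszul_differential_graded[OF d]
  have mono: "w \<in> grass_alg n W \<Longrightarrow> w \<in> grass_alg n V" for w :: "'r grass"
    using grass_alg_mono W by blast
  have "koszul_differential n W g (koszul_d W g)"
    using V W by (intro koszul_differential_exists) (auto intro: finite_subset)
  then have closed: "d w \<in> grass_alg n W" if "w \<in> grass_alg n W" for w
    using that koszul_differential_eq[OF d V mono[OF that]] koszul_d_subset[OF V(1) W that]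
      graded_map_closed[OF koszul_differential_graded] by metis
  have "graded_map n 1 (grass_cplx n W d) (grass_cplx n W d) d"
    by (rule graded_mapI)
      (simp_all add: closed mono graded_map_add[OF gr] graded_map_gscale[OF gr] graded_map_gpart[OF gr])
  moreover have "d (gen v) = gscale (g v) gone" if "v \<in> W" for v
    using d W that by (auto simp: koszul_differential_def)
  ultimately show ?thesis
    using koszul_differential_leibniz[OF d] mono
    unfolding koszul_differential_def hom_elems_def by simp
qed

section \<open>Berezin integration over a set of variables\<close>

text \<open>
  The sign between a monomial and the product of its parts in \<open>U\<close> and in \<open>V\<close> can be absorbed into the
  coefficient, so the order in which the variables of \<open>U\<close> and \<open>V\<close> are interleaved does not matter.
\<close>

lemma grass_alg_Un_induct [consumes 2, case_names zero mult add]: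
  fixes w :: "'r::{comm_ring,comm_monoid_mult} grass"
  assumes "w \<in> grass_alg n (U \<union> V)" "U \<inter> V = {}" "P 0"
    and mult: "\<And>S T a. S \<subseteq> U \<Longrightarrow> T \<subseteq> V \<Longrightarrow> a \<in> Rx n \<Longrightarrow> P (Poly_Mapping.single S a \<star> gmono T)"
    and "\<And>u w. u \<in> grass_alg n (U \<union> V) \<Longrightarrow> w \<in> grass_alg n (U \<union> V) \<Longrightarrow> P u \<Longrightarrow> P w \<Longrightarrow> P (u + w)"
  shows "P w"
  using assms(1)
proof (induction w rule: grass_alg_induct')
  case (single S a)
  let ?k = "of_nat (inversions (S \<inter> U) (S \<inter> V)) :: bit"
  have S: "(S \<inter> U) \<inter> (S \<inter> V) = {}" "(S \<inter> U) \<union> (S \<inter> V) = S"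
    using single assms(2) by auto
  have "Poly_Mapping.single (S \<inter> U) (sg ?k a) \<star> gmono (S \<inter> V) = Poly_Mapping.single S (sg ?k (sg ?k a))"
    unfolding gmono_def single_mult_term S mult_pconst_one by (simp only: if_True simp_thms)
  also have "sg ?k (sg ?k a) = a"
    by (cases ?k) simp_all
  finally show ?case
    using mult[of "S \<inter> U" "S \<inter> V" "sg ?k a"] single by (simp add: Rx_sg)
qed (use assms in auto)

lemma det_op_single:
  assumes "finite V"
  shows "det_op V (Poly_Mapping.single S a) =
    (if V \<subseteq> S then Poly_Mapping.single (S - V)
       (sg (of_nat (inversions (S - V) V) + of_nat (card V) * of_nat (card (S - V))) a) else 0)"
proof -
  have "S \<inter> V = V \<longleftrightarrow> V \<subseteq> S"
    by blast
  then show ?thesis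
    unfolding det_op_def param_ext_def by (subst lin_ext_single) (auto simp: det_fun_gmono)
qed

lemma det_op_add: "det_op V (u + w) = det_op V u + det_op V w"
  unfolding det_op_def param_ext_def by (rule lin_ext_add) (simp_all add: distrib_right sg_add single_add)

lemma det_op_zero [simp]: "det_op V 0 = 0"
  by (simp add: det_op_def param_ext_def)

text \<open>
  The rule \<open>\<phi>(\<theta> w) = (-1)\<^sup>|\<^sup>\<phi>\<^sup>|\<^sup>|\<^sup>\<theta>\<^sup>| \<theta> \<phi>(w)\<close>, with the sign written as a twist of \<open>\<theta>\<close>.
\<close>

lemma det_op_mult:
  fixes u w :: "'r::{comm_ring,comm_monoid_mult} grass"
  assumes disj: "U \<inter> V = {}" and u: "u \<in> grass_alg n U" and w: "w \<in> grass_alg n V"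
  shows "det_op V (u \<star> w) = gscale (det_fun V w) (twist (of_nat (card V)) u)"
  using w
proof (induction w rule: grass_alg_induct)
  case (single T b)
  show ?case
    using u
  proof (induction u rule: grass_alg_induct)
    case (single S a)
    have e: "Poly_Mapping.single S a \<star> Poly_Mapping.single T b = gscale (a * b) (gmono S \<star> gmono T)"
      by (simp add: gmono_def single_mult_term gscale_single sg_mult_right)
    have g: "det_op V (gscale c x) = gscale c (det_op V x)" if "x \<in> grass_alg n (U \<union> V)" for c and x :: "'r grass"
      using that unfolding det_op_def param_ext_def
      by (induction x rule: grass_alg_induct)
        (simp_all add: gscale_add gscale_single sg_mult_right ac_simps lin_ext_add distrib_left distrib_right sg_add single_add)
    have "gmono S \<star> gmono T \<in> (grass_alg n (U \<union> V) :: 'r grass set)"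
      using \<open>T \<subseteq> V\<close> \<open>S \<subseteq> U\<close> by (intro gmult_closed gmono_closed) auto
    moreover have "S \<inter> V = {}"
      using \<open>S \<subseteq> U\<close> disj by blast
    ultimately have "det_op V (Poly_Mapping.single S a \<star> Poly_Mapping.single T b) =
        gscale (a * b) (sg (of_nat (card V) * of_nat (card S)) (gscale (det_fun V (gmono T)) (gmono S)))"
      using param_ext_gmono[of S V T "of_nat (card V)" "det_fun V :: 'r grass \<Rightarrow> _"] \<open>T \<subseteq> V\<close>
      unfolding e by (simp only: g det_op_def[symmetric])
    then show ?case
      by (cases "T = V")
        (simp_all only: det_fun_gmono det_fun_def lookup_single_eq lookup_single_not_eq twist_single gmono_def
          gscale_sg gscale_single single_sg mult_pconst_one mult.commute[of b a] gscale_zero_left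
          mult_zero_left mult_zero_right single_zero
          if_True if_False sg_zero gscale_zero not_False_eq_True)
  qed (simp_all add: gmult_add_left det_op_add twist_add gscale_add)
qed (simp_all add: gmult_add_right det_op_add det_fun_def lookup_add gscale_add_left)

lemma det_op_graded:
  assumes U: "finite U" and V: "finite V"
  shows "graded_map n (of_nat (card V)) (grass_cplx n (U \<union> V) d) (grass_cplx n U e) (det_op V)"
proof (rule graded_mapI)
  fix u w :: "'a grass" and a q assume w: "w \<in> grass_alg n (U \<union> V)"
  show "det_op V w \<in> grass_alg n U"
    using w
  proof (induction w rule: grass_alg_induct)
    case (single S a)
    then have "S - V \<subseteq> U"
      by blast
    with single show ?case
      unfolding det_op_single[OF V] by (metis grass_alg_single grass_alg_zero Rx_sg)
  qed (simp_all add: det_op_add grass_alg_zero grass_alg_add)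
  show "det_op V (gscale a w) = gscale a (det_op V w)"
    using w
    by (induction w rule: grass_alg_induct)
      (simp_all add: det_op_add gscale_add gscale_single det_op_single[OF V] sg_mult_right)
  show "gpart (of_nat (card V) + q) (det_op V w) = det_op V (gpart q w)"
    using w
  proof (induction w rule: grass_alg_induct)
    case (single S a)
    have "finite S"
      using single(1) U V finite_subset by blast
    show ?case
    proof (cases "V \<subseteq> S")
      case True
      have "card S = card V + card (S - V)"
        using card_Diff_subset[OF V True] card_mono[OF \<open>finite S\<close> True] by linarith
      then have card: "of_nat (card S) = (of_nat (card V) + of_nat (card (S - V)) :: bit)"
        by (simp only: of_nat_add)
      have "a = b + q \<longleftrightarrow> b + a = q" for a b :: bit
        by (cases a; cases b; cases q) simp_all
      then have "of_nat (card (S - V)) = of_nat (card V) + q \<longleftrightarrow> of_nat (card S) = q"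
        by (simp only: card)
      then show ?thesis
        by (cases "of_nat (card S) = q")
          (simp_all only: True det_op_single[OF V] gpart_single gpart_zero det_op_zero if_True if_False simp_thms)
    qed (simp add: det_op_single[OF V] gpart_single)
  qed (simp_all add: det_op_add gpart_add)
qed (rule det_op_add)

text \<open>
  The functional \<open>det\<close> vanishes on all boundaries \<open>\<partial>w\<close> with \<open>w\<close> in the variables \<open>V\<close> (\<open>top\<close> below),
  since contraction removes a variable. Only the term \<open>\<partial>u \<star> w\<close> of the Leibniz rule survives, and the
  sign \<open>(-1)\<^sup>t\<close> arises from moving \<open>\<partial>\<close> past the twist by which \<open>det_op\<close> acts on \<open>u\<close>.
\<close>

lemma det_op_complex_morphism:
  fixes d :: "'r::{comm_ring,comm_monoid_mult} grass \<Rightarrow> 'r grass"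
  assumes d: "koszul_differential n (U \<union> V) g d" and fin: "finite U" "finite V"
    and g: "\<forall>v\<in>U \<union> V. g v \<in> Rx n" and disj: "U \<inter> V = {}"
  shows "complex_morphism n (of_nat (card V)) (grass_cplx n (U \<union> V) d) (grass_cplx n U d) (det_op V)"
proof -
  let ?t = "of_nat (card V) :: bit"
  note dU = koszul_differential_subset[OF d _ g, of U] and dV = koszul_differential_subset[OF d _ g, of V]
  have D: "koszul_differential n U g d" "koszul_differential n V g d"
    using dU dV fin by auto
  note gr = koszul_differential_graded[OF d] and grU = koszul_differential_graded[OF D(1)]
    and grV = koszul_differential_graded[OF D(2)] and dg = det_op_graded[OF fin]
  have top: "det_fun V (d w) = 0" if w: "w \<in> grass_alg n V" for w
  proof -
    have "Poly_Mapping.lookup (contract v w) V = 0" if "v \<in> V" for v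
      using w that
      by (induction w rule: grass_alg_induct) (auto simp: contract_single contract_add lookup_single lookup_add when_def)
    then show ?thesis
      using koszul_differential_eq[OF D(2) fin(2) _ w] g
      by (simp add: det_fun_def koszul_d_def lookup_sum lookup_gscale)
  qed
  have "d (det_op V w) = sg ?t (det_op V (d w))" if "w \<in> grass_alg n (U \<union> V)" for w
    using that disj
  proof (induction w rule: grass_alg_Un_induct)
    case zero
    then show ?case by (simp add: graded_map_zero[OF gr])
  next
    case (add u w)
    then show ?case
      by (simp add: det_op_add graded_map_add[OF gr] graded_map_add[OF grU] graded_map_closed[OF dg] sg_add)
  next
    case (mult S T a)
    let ?u = "Poly_Mapping.single S a" and ?w = "gmono T :: 'r grass" and ?p = "of_nat (card S) :: bit"
    have u: "?u \<in> grass_alg n U" and w: "?w \<in> grass_alg n V"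
      using mult by (auto intro: grass_alg_single gmono_closed)
    have UV: "?u \<in> grass_alg n (U \<union> V)" "?w \<in> grass_alg n (U \<union> V)"
      using u w grass_alg_mono[of U "U \<union> V"] grass_alg_mono[of V "U \<union> V"] by blast+
    have "det_op V (d (?u \<star> ?w)) = det_op V (d ?u \<star> ?w) + sg ?p (det_op V (?u \<star> d ?w))"
    proof -
      have "gpart ?p ?u = ?u"
        by (simp add: gpart_single)
      moreover have "?u \<star> d ?w \<in> grass_alg n (U \<union> V)"
        using UV by (intro gmult_closed graded_map_closed[OF gr])
      ultimately show ?thesis
        using koszul_differential_leibniz[OF d UV(1) _ UV(2)]
        by (simp add: det_op_add graded_map_sg[OF dg])
    qed
    also have "\<dots> = gscale (det_fun V ?w) (twist ?t (d ?u))"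
      using det_op_mult[OF disj graded_map_closed[OF grU u] w]
        det_op_mult[OF disj u graded_map_closed[OF grV w]] top[OF w] by simp
    also have "twist ?t (d ?u) = sg ?t (d (twist ?t ?u))"
      using graded_map_twist[OF grU u, of ?t] by (cases ?t) simp_all
    also have "gscale (det_fun V ?w) (sg ?t (d (twist ?t ?u))) = sg ?t (d (gscale (det_fun V ?w) (twist ?t ?u)))"
    proof -
      have "det_fun V ?w \<in> Rx n"
        unfolding det_fun_def by (rule grass_alg_coeff[OF w])
      then show ?thesis
        by (simp add: gscale_sg graded_map_gscale[OF grU] twist_closed[OF u])
    qed
    also have "gscale (det_fun V ?w) (twist ?t ?u) = det_op V (?u \<star> ?w)"
      using det_op_mult[OF disj u w] by simp
    finally show ?case
      by (cases ?t) simp_all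
  qed
  then show ?thesis
    unfolding complex_morphism_grass_iff using dg by blast
qed

section \<open>Increasing substitutions\<close>

text \<open>
  An increasing substitution maps the sorted word of \<open>S\<close> to the sorted word of the image, so
  reordering the factors produces no sign.
\<close>

lemma gsubst_single:
  fixes a :: "'r::{comm_ring,comm_monoid_mult} mpoly"
  assumes "finite S" "strict_mono_on S \<sigma>"
  shows "gsubst \<sigma> (Poly_Mapping.single S a) = Poly_Mapping.single (\<sigma> ` S) a"
proof -
  let ?xs = "sorted_list_of_set S"
  have "sorted_wrt (<) (map \<sigma> ?xs)"
    unfolding sorted_wrt_map
    by (rule sorted_wrt_mono_rel[OF _ strict_sorted_list_of_set])
      (use assms in \<open>auto simp: strict_mono_on_def\<close>)
  then have "sorted (map \<sigma> ?xs)" "distinct (map \<sigma> ?xs)"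
    by (simp_all only: strict_sorted_iff)
  from foldr_gen[OF this] have "foldr (\<lambda>v w. gen (\<sigma> v) \<star> w) ?xs gone = (gmono (\<sigma> ` S) :: 'r grass)"
    using assms by (simp add: foldr_map comp_def)
  then show ?thesis
    unfolding gsubst_def by (subst lin_ext_single) (simp_all add: gmono_def gscale_single)
qed

lemma gsubst_add: "gsubst \<sigma> (u + w) = gsubst \<sigma> u + gsubst \<sigma> w"
  unfolding gsubst_def by (rule lin_ext_add) (simp_all add: gscale_add_left)

lemma gsubst_zero [simp]: "gsubst \<sigma> 0 = 0"
  by (simp add: gsubst_def)

lemma gsubst_sum: "gsubst \<sigma> (sum h A) = (\<Sum>v\<in>A. gsubst \<sigma> (h v))"
  by (induction A rule: infinite_finite_induct) (simp_all add: gsubst_add)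

text \<open>
  The two counts that enter the signs of \<open>det_op\<close> and of \<open>contract\<close> depend only on the relative order
  of the variables.
\<close>

lemma inverted_pairs_image:
  fixes \<sigma> :: "'a::linorder \<Rightarrow> 'b::linorder"
  assumes "strict_mono_on (S \<union> T) \<sigma>"
  shows "card {(a, b). a \<in> \<sigma> ` S \<and> b \<in> \<sigma> ` T \<and> b < a} = card {(a, b). a \<in> S \<and> b \<in> T \<and> b < a}"
proof -
  have "\<sigma> b < \<sigma> a \<longleftrightarrow> b < a" if "a \<in> S" "b \<in> T" for a b
    using that assms by (simp add: strict_mono_on_less)
  then have "{(a, b). a \<in> \<sigma> ` S \<and> b \<in> \<sigma> ` T \<and> b < a} = map_prod \<sigma> \<sigma> ` {(a, b). a \<in> S \<and> b \<in> T \<and> b < a}"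
    by (auto simp: image_iff)
  moreover have "inj_on (map_prod \<sigma> \<sigma>) {(a, b). a \<in> S \<and> b \<in> T \<and> b < a}"
    using strict_mono_on_imp_inj_on[OF assms] by (auto simp: inj_on_def)
  ultimately show ?thesis
    by (simp add: card_image)
qed

lemma card_smaller_image:
  fixes \<sigma> :: "'a::linorder \<Rightarrow> 'b::linorder"
  assumes "strict_mono_on (insert v S) \<sigma>"
  shows "card {u \<in> \<sigma> ` S. u < \<sigma> v} = card {u \<in> S. u < v}"
proof -
  have "\<sigma> u < \<sigma> v \<longleftrightarrow> u < v" if "u \<in> S" for u
    using that assms by (simp add: strict_mono_on_less)
  then have "{u \<in> \<sigma> ` S. u < \<sigma> v} = \<sigma> ` {u \<in> S. u < v}"
    by auto
  moreover have "inj_on \<sigma> {u \<in> S. u < v}"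
    using strict_mono_on_imp_inj_on[OF assms] by (rule inj_on_subset) blast
  ultimately show ?thesis
    by (simp add: card_image)
qed

lemma inversions_image:
  "strict_mono_on (S \<union> T) \<sigma> \<Longrightarrow> inversions (\<sigma> ` S) (\<sigma> ` T) = inversions S T"
  unfolding inversions_def by (rule inverted_pairs_image)

context
  fixes \<sigma> :: "gvar \<Rightarrow> gvar" and V :: "gvar set"
  assumes V: "finite V" and \<sigma>: "strict_mono_on V \<sigma>"
begin

lemma gsubst_single_subset:
  "S \<subseteq> V \<Longrightarrow> gsubst \<sigma> (Poly_Mapping.single S a) = Poly_Mapping.single (\<sigma> ` S) a"
  for a :: "'r::{comm_ring,comm_monoid_mult} mpoly"
  using V \<sigma> by (intro gsubst_single) (auto intro: finite_subset monotone_on_subset)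

lemma card_gsubst: "S \<subseteq> V \<Longrightarrow> card (\<sigma> ` S) = card S"
  by (intro card_image inj_on_subset[OF strict_mono_on_imp_inj_on[OF \<sigma>]])

lemma gsubst_closed: "w \<in> grass_alg n V \<Longrightarrow> gsubst \<sigma> w \<in> grass_alg n (\<sigma> ` V)"
  by (induction w rule: grass_alg_induct)
    (auto simp: gsubst_single_subset gsubst_add intro!: grass_alg_single grass_alg_zero grass_alg_add)

lemma gsubst_gscale: "w \<in> grass_alg n V \<Longrightarrow> gsubst \<sigma> (gscale a w) = gscale a (gsubst \<sigma> w)"
  by (induction w rule: grass_alg_induct)
    (simp_all add: gsubst_single_subset gsubst_add gscale_add gscale_single)

lemma gsubst_gpart: "w \<in> grass_alg n V \<Longrightarrow> gsubst \<sigma> (gpart p w) = gpart p (gsubst \<sigma> w)"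
  by (induction w rule: grass_alg_induct)
    (simp_all add: gsubst_single_subset gsubst_add gpart_add gpart_single card_gsubst)

lemma gsubst_comp:
  assumes \<tau>: "strict_mono_on (\<sigma> ` V) \<tau>" and w: "w \<in> grass_alg n V"
  shows "gsubst \<tau> (gsubst \<sigma> w) = gsubst (\<tau> \<circ> \<sigma>) w"
  using w
proof (induction w rule: grass_alg_induct)
  case (single S a)
  then have "finite S" "strict_mono_on (\<sigma> ` S) \<tau>" "strict_mono_on S \<sigma>"
    using V \<sigma> \<tau> by (auto intro: finite_subset monotone_on_subset)
  moreover from this have "strict_mono_on S (\<tau> \<circ> \<sigma>)"
    unfolding strict_mono_on_def comp_def by blast
  ultimately show ?case
    by (simp only: gsubst_single finite_imageI image_comp)
qed (simp_all add: gsubst_add)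

lemma contract_gsubst:
  assumes v: "v \<in> V" and w: "w \<in> grass_alg n V"
  shows "contract (\<sigma> v) (gsubst \<sigma> w) = gsubst \<sigma> (contract v w)"
  using w
proof (induction w rule: grass_alg_induct)
  case (single S a)
  have inj: "inj_on \<sigma> V"
    using \<sigma> by (rule strict_mono_on_imp_inj_on)
  then have "\<sigma> v \<in> \<sigma> ` S \<longleftrightarrow> v \<in> S" and "\<sigma> ` (S - {v}) = \<sigma> ` S - {\<sigma> v}"
    using v single(1) inj_on_image_mem_iff[OF inj v single(1)] inj_on_image_set_diff[OF inj, of S "{v}"]
    by auto
  moreover have "card {u \<in> \<sigma> ` S. u < \<sigma> v} = card {u \<in> S. u < v}"
    using single(1) v by (intro card_smaller_image monotone_on_subset[OF \<sigma>]) blast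
  moreover have "S - {v} \<subseteq> V"
    using single(1) by blast
  ultimately show ?case
    using single(1) by (simp add: gsubst_single_subset contract_single)
qed (simp_all add: gsubst_add contract_add)

lemma koszul_d_gsubst:
  fixes g h :: "gvar \<Rightarrow> 'r::{comm_ring,comm_monoid_mult} mpoly"
  assumes "\<forall>v\<in>V. h (\<sigma> v) = g v" and w: "w \<in> grass_alg n V"
  shows "koszul_d (\<sigma> ` V) h (gsubst \<sigma> w) = gsubst \<sigma> (koszul_d V g w)"
proof -
  have "koszul_d (\<sigma> ` V) h (gsubst \<sigma> w) = (\<Sum>v\<in>V. gscale (h (\<sigma> v)) (contract (\<sigma> v) (gsubst \<sigma> w)))"
    unfolding koszul_d_def by (simp add: sum.reindex[OF strict_mono_on_imp_inj_on[OF \<sigma>]])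
  also have "\<dots> = (\<Sum>v\<in>V. gsubst \<sigma> (gscale (g v) (contract v w)))"
    using assms(1) contract_gsubst[OF _ w] gsubst_gscale[OF contract_closed[OF w]]
    by (intro sum.cong refl) metis
  finally show ?thesis
    by (simp only: koszul_d_def gsubst_sum)
qed

text \<open>
  By \<open>koszul_d_gsubst\<close> the renaming commutes with the Koszul formulas over \<open>V\<close> and over its image; in
  the target, the formula over the image may be replaced by the one over all of \<open>W\<close>.
\<close>

lemma gsubst_complex_morphism:
  fixes d e :: "'r::{comm_ring,comm_monoid_mult} grass \<Rightarrow> 'r grass"
  assumes d: "koszul_differential n V g d" and e: "koszul_differential n W h e" and W: "finite W" "\<sigma> ` V \<subseteq> W"
    and gh: "\<forall>v\<in>V. h (\<sigma> v) = g v" and g: "\<forall>v\<in>V. g v \<in> Rx n" and h: "\<forall>v\<in>W. h v \<in> Rx n"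
  shows "complex_morphism n 0 (grass_cplx n V d) (grass_cplx n W e) (gsubst \<sigma>)"
proof -
  have closed: "gsubst \<sigma> w \<in> grass_alg n W" if "w \<in> grass_alg n V" for w :: "'r grass"
    using grass_alg_mono[OF W(2) gsubst_closed[OF that]] .
  have "e (gsubst \<sigma> w) = gsubst \<sigma> (d w)" if w: "w \<in> grass_alg n V" for w
    using koszul_d_gsubst[OF gh w] koszul_d_subset[OF W gsubst_closed[OF w]]
      koszul_differential_eq[OF d V g w] koszul_differential_eq[OF e W(1) h closed[OF w]] by simp
  then show ?thesis
    unfolding complex_morphism_grass_iff
    by (auto intro!: graded_mapI simp: closed gsubst_add gsubst_gscale gsubst_gpart)
qed

lemma det_op_gsubst:
  fixes w :: "'r::{comm_ring,comm_monoid_mult} grass"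
  assumes B: "B \<subseteq> V" and w: "w \<in> grass_alg n V"
  shows "det_op (\<sigma> ` B) (gsubst \<sigma> w) = gsubst \<sigma> (det_op B w)"
  using w
proof (induction w rule: grass_alg_induct)
  case (single S a)
  have inj: "inj_on \<sigma> V"
    using \<sigma> by (rule strict_mono_on_imp_inj_on)
  have sub: "\<sigma> ` B \<subseteq> \<sigma> ` S \<longleftrightarrow> B \<subseteq> S"
    unfolding image_subset_iff using inj_on_image_mem_iff[OF inj _ single(1)] B by blast
  have diff: "\<sigma> ` S - \<sigma> ` B = \<sigma> ` (S - B)"
    using inj_on_image_set_diff[OF inj, of S B] B single(1) by auto
  have inv: "inversions (\<sigma> ` (S - B)) (\<sigma> ` B) = inversions (S - B) B"
    using B single(1) by (intro inversions_image monotone_on_subset[OF \<sigma>]) auto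
  have SB: "S - B \<subseteq> V"
    using single(1) by blast
  have fin: "finite B" "finite (\<sigma> ` B)"
    using V B by (auto intro: finite_subset)
  show ?case
    by (simp only: gsubst_single_subset[OF single(1)] gsubst_single_subset[OF SB] det_op_single[OF fin(1)]
        det_op_single[OF fin(2)] sub diff inv card_gsubst[OF B] card_gsubst[OF SB] gsubst_zero split: if_split) simp
qed (simp_all add: gsubst_add det_op_add)

end

lemma gsubst_id:
  fixes w :: "'r::{comm_ring,comm_monoid_mult} grass"
  assumes V: "finite V" "\<forall>v\<in>V. \<sigma> v = v" and w: "w \<in> grass_alg n V"
  shows "gsubst \<sigma> w = w"
proof -
  have mono: "strict_mono_on V \<sigma>"
    unfolding strict_mono_on_def using V(2) by metis
  have "\<sigma> ` S = S" if "S \<subseteq> V" for S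
  proof -
    have "\<sigma> ` S = id ` S"
      by (rule image_cong) (use that V(2) in auto)
    then show ?thesis
      by simp
  qed
  note fixed = this
  show ?thesis
    using w
    by (induction w rule: grass_alg_induct)
      (simp_all add: gsubst_single_subset[OF V(1) mono] gsubst_add fixed)
qed

section \<open>Pullback of functionals\<close>

lemma dual_cplx_simps [simp]:
  "czero (dual_cplx K) = (\<lambda>w \<in> car K. 0)"
  "cadd (dual_cplx K) = (\<lambda>L M. \<lambda>w \<in> car K. L w + M w)"
  "csmul (dual_cplx K) = (\<lambda>a L. \<lambda>w \<in> car K. L (csmul K a w))"
  "cpart (dual_cplx K) = (\<lambda>p L. \<lambda>w \<in> car K. L (cpart K p w))"
  by (simp_all add: dual_cplx_def)

context
  fixes n :: nat and V :: "gvar set" and d :: "'r::{comm_ring,comm_monoid_mult} grass \<Rightarrow> 'r grass"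
    and c :: "'r grass \<Rightarrow> 'r"
  assumes c: "c \<in> car (dual_cplx (grass_cplx n V d))"
begin

lemma dual_add: "u \<in> grass_alg n V \<Longrightarrow> w \<in> grass_alg n V \<Longrightarrow> c (u + w) = c u + c w"
  using c by (simp add: dual_cplx_def)

lemma dual_pconst: "w \<in> grass_alg n V \<Longrightarrow> c (gscale (pconst r) w) = r * c w"
  using c by (simp add: dual_cplx_def)

lemma dual_zero: "c 0 = 0"
  using dual_add[of 0 0] grass_alg_zero[of n V] by simp

lemma dual_sg: "w \<in> grass_alg n V \<Longrightarrow> c (sg q w) = sg q (c w)"
  using dual_add[of w "- w"] dual_zero
  by (cases q) (simp_all add: grass_alg_uminus eq_neg_iff_add_eq_0 add.commute)

lemma dual_twist: "w \<in> grass_alg n V \<Longrightarrow> c (gpart 0 w) + sg q (c (gpart 1 w)) = c (twist q w)"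
  by (simp add: twist_def dual_add dual_sg grass_alg_gpart grass_alg_sg)

end

text \<open>
  In terms of the twist, \<open>\<partial>[c] = - c \<circ> twist 1 \<circ> \<partial>\<close>: for \<open>c\<close> of parity \<open>p\<close>, only the component of
  parity \<open>p\<close> of \<open>\<partial>w\<close> contributes, and the twist gives it the sign \<open>(-1)\<^sup>p\<close>.
\<close>

lemma dual_diff:
  assumes c: "c \<in> car (dual_cplx (grass_cplx n V d))" and d: "\<And>w. w \<in> grass_alg n V \<Longrightarrow> d w \<in> grass_alg n V"
  shows "cdiff (dual_cplx (grass_cplx n V d)) c = (\<lambda>w \<in> grass_alg n V. - c (twist 1 (d w)))"
  by (auto simp: dual_cplx_def fun_eq_iff restrict_def d simp flip: dual_twist[OF c])

lemma pull_apply: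
  assumes c: "c \<in> car (dual_cplx (grass_cplx n W e))" and \<phi>: "\<And>w. w \<in> grass_alg n V \<Longrightarrow> \<phi> w \<in> grass_alg n W"
  shows "pull p (grass_cplx n V d) (grass_cplx n W e) \<phi> c = (\<lambda>w \<in> grass_alg n V. c (twist p (\<phi> w)))"
  using dual_twist[OF c \<phi>] by (auto simp: pull_def fun_eq_iff restrict_def \<phi>)

lemma dual_carI:
  assumes "\<And>u w. u \<in> grass_alg n V \<Longrightarrow> w \<in> grass_alg n V \<Longrightarrow> c (u + w) = c u + c w"
    and "\<And>r w. w \<in> grass_alg n V \<Longrightarrow> c (gscale (pconst r) w) = r * c w"
  shows "(\<lambda>w \<in> grass_alg n V. c w) \<in> car (dual_cplx (grass_cplx n V d))"
  using assms by (simp add: dual_cplx_def grass_alg_add grass_alg_gscale Rx_pconst)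

text \<open>
  With \<open>\<gamma>\<^sub>q\<close> for the twist, the pullback is \<open>c \<mapsto> c \<circ> \<gamma>\<^sub>p \<circ> \<phi>\<close> and the dual differential is
  \<open>c \<mapsto> - c \<circ> \<gamma>\<^sub>1 \<circ> \<partial>\<close>. Applying them in either order to \<open>c\<close>, one has to compare
  \<open>\<gamma>\<^sub>p \<phi> \<gamma>\<^sub>1 \<partial>\<close> with \<open>\<gamma>\<^sub>1 \<partial> \<gamma>\<^sub>p \<phi>\<close>. Moving the twists to the left turns the first into
  \<open>(-1)\<^sup>p \<gamma>\<^sub>p \<gamma>\<^sub>1 \<phi> \<partial>\<close> and the second into \<open>(-1)\<^sup>p \<gamma>\<^sub>1 \<gamma>\<^sub>p \<partial> \<phi> = \<gamma>\<^sub>1 \<gamma>\<^sub>p \<phi> \<partial>\<close>, so they differ by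
  \<open>(-1)\<^sup>p\<close>, as required.
\<close>

lemma pull_complex_morphism:
  fixes \<phi> :: "'r::{comm_ring,comm_monoid_mult} grass \<Rightarrow> 'r grass"
  assumes \<phi>: "complex_morphism n p (grass_cplx n V d) (grass_cplx n W e) \<phi>"
    and d: "graded_map n 1 (grass_cplx n V d) (grass_cplx n V d) d"
    and e: "graded_map n 1 (grass_cplx n W e) (grass_cplx n W e) e"
  shows "complex_morphism n p (dual_cplx (grass_cplx n W e)) (dual_cplx (grass_cplx n V d))
           (pull p (grass_cplx n V d) (grass_cplx n W e) \<phi>)"
    (is "complex_morphism n p ?L ?K ?\<Phi>")
proof -
  note g = \<phi>[unfolded complex_morphism_grass_iff, THEN conjunct1]
  note \<phi>cl = graded_map_closed[OF g] and dcl = graded_map_closed[OF d] and ecl = graded_map_closed[OF e]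
  note cl = twist_closed[OF \<phi>cl]
  have P: "?\<Phi> c = (\<lambda>w \<in> grass_alg n V. c (twist p (\<phi> w)))" if "c \<in> car ?L" for c
    using that by (rule pull_apply) (rule \<phi>cl)
  have DL: "cdiff ?L c = (\<lambda>w \<in> grass_alg n W. - c (twist 1 (e w)))" if "c \<in> car ?L" for c
    using that by (rule dual_diff) (rule ecl)
  have DK: "cdiff ?K c = (\<lambda>w \<in> grass_alg n V. - c (twist 1 (d w)))" if "c \<in> car ?K" for c
    using that by (rule dual_diff) (rule dcl)
  have closed: "?\<Phi> c \<in> car ?K" if c: "c \<in> car ?L" for c
    unfolding P[OF c]
    by (rule dual_carI)
      (simp_all add: graded_map_add[OF g] graded_map_gscale[OF g] Rx_pconst twist_add twist_gscale
        dual_add[OF c] dual_pconst[OF c] cl)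
  have add: "cadd ?L c c' \<in> car ?L" if c: "c \<in> car ?L" "c' \<in> car ?L" for c c'
    using dual_carI[of n W "\<lambda>w. c w + c' w" e]
    by (simp add: dual_add[OF c(1)] dual_add[OF c(2)] dual_pconst[OF c(1)] dual_pconst[OF c(2)] algebra_simps)
  have smul: "csmul ?L a c \<in> car ?L" if c: "c \<in> car ?L" and a: "a \<in> Rx n" for a c
    using dual_carI[of n W "\<lambda>w. c (gscale a w)" e] a
    by (simp add: dual_add[OF c] dual_pconst[OF c] gscale_add grass_alg_gscale gscale_gscale[of a "pconst _"])
  have diff: "cdiff ?L c \<in> car ?L" if c: "c \<in> car ?L" for c
    unfolding DL[OF c]
    by (rule dual_carI)
      (simp_all add: graded_map_add[OF e] graded_map_gscale[OF e] Rx_pconst twist_add twist_gscale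
        dual_add[OF c] dual_pconst[OF c] twist_closed ecl)
  have parity: "cpart ?K (p + q) (?\<Phi> c) = ?\<Phi> c" if c: "c \<in> car ?L" and q: "cpart ?L q c = c" for c q
  proof -
    have "c (twist p (\<phi> (gpart (p + q) w))) = c (twist p (\<phi> w))" if w: "w \<in> grass_alg n V" for w
    proof -
      have "p + (p + q) = q"
        by (cases p; cases q) simp_all
      then have "twist p (\<phi> (gpart (p + q) w)) = gpart q (twist p (\<phi> w))"
        using graded_map_gpart[OF g w, of "p + q"] by (simp only: twist_gpart)
      moreover have "c (gpart q x) = c x" if "x \<in> grass_alg n W" for x
        using fun_cong[OF q, of x] that by simp
      ultimately show ?thesis
        by (simp add: cl w)
    qed
    then show ?thesis
      unfolding P[OF c] by (auto simp: fun_eq_iff restrict_def grass_alg_gpart)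
  qed
  have graded: "graded_map n p ?L ?K ?\<Phi>"
    unfolding graded_map_def hom_elems_def
  proof (intro conjI ballI allI CollectI)
    fix c c' assume c: "c \<in> car ?L" "c' \<in> car ?L"
    show "?\<Phi> (cadd ?L c c') = cadd ?K (?\<Phi> c) (?\<Phi> c')"
      unfolding P[OF add[OF c]] P[OF c(1)] P[OF c(2)] by (auto simp: fun_eq_iff restrict_def cl)
  next
    fix c and a :: "'r mpoly" assume "a \<in> Rx n" "c \<in> car ?L"
    then show "?\<Phi> (csmul ?L a c) = csmul ?K a (?\<Phi> c)"
      unfolding P[OF smul[OF \<open>c \<in> car ?L\<close> \<open>a \<in> Rx n\<close>]] P[OF \<open>c \<in> car ?L\<close>]
      by (auto simp: fun_eq_iff restrict_def cl grass_alg_gscale graded_map_gscale[OF g] twist_gscale)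
  qed (use closed parity in auto)
  have "bracket p ?L ?K ?\<Phi> c = czero ?K" if c: "c \<in> car ?L" for c
  proof -
    have "- c (twist p (\<phi> (twist 1 (d w)))) + - sg p (- c (twist 1 (e (twist p (\<phi> w))))) = 0"
      if w: "w \<in> grass_alg n V" for w
    proof -
      let ?x = "twist p (twist 1 (\<phi> (d w)))"
      have x: "?x \<in> grass_alg n W"
        by (intro twist_closed \<phi>cl dcl w)
      have "twist p (\<phi> (twist 1 (d w))) = sg p ?x"
        unfolding graded_map_twist[OF g dcl[OF w]] by (simp only: twist_sg mult_1_right)
      moreover have "e (twist p (\<phi> w)) = twist p (\<phi> (d w))"
      proof -
        have "e (\<phi> w) = sg p (\<phi> (d w))"
          using \<phi> w by (simp add: complex_morphism_grass_iff)
        then show ?thesis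
          unfolding graded_map_twist[OF e \<phi>cl[OF w]] by (simp only: \<open>e (\<phi> w) = _\<close> twist_sg sg_sg sg_simps mult_1_left bit_double)
      qed
      ultimately show ?thesis
        using dual_sg[OF c x, of p] twist_twist_comm[of 1 p "\<phi> (d w)"] by (cases p) simp_all
    qed
    moreover have "?\<Phi> (cdiff ?L c) (gscale (- sg p (pconst 1)) w) =
        - sg p (- c (twist 1 (e (twist p (\<phi> w)))))" if w: "w \<in> grass_alg n V" for w
    proof -
      note M = closed[OF diff[OF c]]
      have "?\<Phi> (cdiff ?L c) (gscale (- sg p (pconst 1)) w) = - sg p (?\<Phi> (cdiff ?L c) w)"
        using dual_sg[OF M w] dual_sg[OF M grass_alg_sg[OF w], of 1 p] by (simp add: gscale_uminus_sg_one)
      also have "?\<Phi> (cdiff ?L c) w = - c (twist 1 (e (twist p (\<phi> w))))"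
        unfolding P[OF diff[OF c]] unfolding DL[OF c] by (simp add: cl w)
      finally show ?thesis .
    qed
    ultimately show ?thesis
      unfolding bracket_def DK[OF closed[OF c]] by (auto simp: fun_eq_iff restrict_def P[OF c] dcl twist_closed)
  qed
  with graded show ?thesis
    by (simp add: complex_morphism_def)
qed

text \<open>
  A functional in primed variables is a functional composed with \<open>unprime\<close>, which is even and can
  therefore be moved into the map without a sign.
\<close>

lemma pull_prime_fun:
  fixes \<phi> :: "'r::{comm_ring,comm_monoid_mult} grass \<Rightarrow> 'r grass"
  assumes \<phi>: "\<And>w. w \<in> grass_alg n V \<Longrightarrow> \<phi> w \<in> grass_alg n W"
    and unprime: "\<And>q (w :: 'r grass). w \<in> grass_alg n W \<Longrightarrow> unprime (gpart q w) = gpart q (unprime w)"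
    and closed: "\<And>w :: 'r grass. w \<in> grass_alg n W \<Longrightarrow> unprime w \<in> grass_alg n U"
  shows "pull p (grass_cplx n V d) (grass_cplx n W d') \<phi> (prime_fun n W c) =
         pull p (grass_cplx n V d) (grass_cplx n U d'') (\<lambda>w. unprime (\<phi> w)) c"
  using assms by (auto simp: pull_def prime_fun_def fun_eq_iff restrict_def grass_alg_gpart)

lemma pull_cong:
  "(\<And>w. w \<in> car K \<Longrightarrow> \<phi> w = \<psi> w) \<Longrightarrow> pull p K L \<phi> c = pull p K L \<psi> c"
  by (auto simp: pull_def fun_eq_iff restrict_def)

section \<open>The blocks of variables\<close>

lemma finite_vars [simp]: "finite (vars b m)"
  by (simp add: vars_def)

lemma card_vars [simp]: "card (vars b m) = m"
  by (simp add: vars_def)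

lemma image_vars: "map_prod \<beta> id ` vars b m = vars (\<beta> b) m"
  by (auto simp: vars_def image_iff)

lemma vars_disjoint: "b \<noteq> b' \<Longrightarrow> vars b m \<inter> vars b' m' = {}"
  by (auto simp: vars_def)

lemma strict_mono_on_block_map:
  fixes \<beta> :: "block \<Rightarrow> block"
  assumes "\<beta> b < \<beta> b'" "b < b'"
  shows "strict_mono_on (vars b m \<union> vars b' m') (map_prod \<beta> id)"
proof -
  have "\<not> b' < b" "b \<noteq> b'" "b' \<noteq> b" "\<not> b' \<le> b"
    using assms(2) by auto
  then show ?thesis
    unfolding strict_mono_on_def vars_def using assms(1) by auto
qed

lemma strict_mono_on_one_block: "strict_mono_on (vars b m) (map_prod \<beta> id)"
  for \<beta> :: "block \<Rightarrow> block"
  unfolding strict_mono_on_def vars_def by auto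

lemma exp_subst_eq: "exp_subst b b' = gsubst (map_prod (\<lambda>k. if k = b' then b else k) id)"
proof -
  have "(\<lambda>(k, i :: nat). (if k = b' then b else k, i)) = map_prod (\<lambda>k. if k = b' then b else k) id"
    by (simp add: fun_eq_iff)
  then show ?thesis
    unfolding exp_subst_def by (rule arg_cong)
qed

text \<open>
  The value of \<open>\<partial>\<close> on a variable does not distinguish primed from unprimed variables, so every block
  map which changes only primes preserves it.
\<close>

lemma gval_eq: "gval f F (k, i) = (if unprime_block k = Blf then f i else F i)"
  by (cases k) simp_all

lemma gval_block_map:
  assumes "unprime_block (\<beta> (fst v)) = unprime_block (fst v)"
  shows "gval f F (map_prod \<beta> id v) = gval f F v"
  by (metis assms gval_eq id_apply map_prod_simp prod.collapse)

lemma det_exp_apply: "det_exp b b' B t w = det_op (vars B t) (exp_subst b b' w)"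
  by (simp add: det_exp_def x0_def)

lemma unit_exp_apply:
  assumes "exp_subst b b' w \<in> grass_alg n V"
  shows "unit_exp b b' w = exp_subst b b' w"
  using assms by (simp add: unit_exp_def x0_def F0_def gmult_gone)

lemma unit_exp_eq:
  "w \<in> grass_alg n (vars b' m) \<Longrightarrow> unit_exp b b' w = exp_subst b b' w"
  unfolding exp_subst_eq by (rule unit_exp_apply[unfolded exp_subst_eq, OF gsubst_closed[OF finite_vars strict_mono_on_one_block]])

lemma gsubst_block_id:
  assumes w: "w \<in> grass_alg n (vars b m)" and \<beta>: "\<beta> b = b"
  shows "gsubst (map_prod \<beta> id) w = w"
  using w by (rule gsubst_id[OF finite_vars, rotated]) (auto simp: vars_def \<beta>)

text \<open>
  Two successive substitutions of blocks, such as adding a prime and removing it again, combine into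
  one, to which \<open>gsubst_block_id\<close> or \<open>det_op_gsubst_block\<close> applies.
\<close>

lemma gsubst_block_comp:
  assumes "strict_mono_on V (map_prod \<alpha> id)" "strict_mono_on (map_prod \<alpha> id ` V) (map_prod \<beta> id)"
    and "finite V" "w \<in> grass_alg n V"
  shows "gsubst (map_prod \<beta> id) (gsubst (map_prod \<alpha> id) w) = gsubst (map_prod (\<beta> \<circ> \<alpha>) id) w"
  using gsubst_comp[OF assms(3,1,2,4)] by (simp only: map_prod.comp id_comp)

lemma det_op_gsubst_block:
  assumes \<beta>: "\<beta> b < \<beta> B" "b < B" "\<beta> b = b" and w: "w \<in> grass_alg n (vars b m \<union> vars B t)"
  shows "det_op (vars (\<beta> B) t) (gsubst (map_prod \<beta> id) w) = det_op (vars B t) w"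
proof -
  have "det_op (vars B t) w \<in> grass_alg n (vars b m)"
    using graded_map_closed[OF det_op_graded[OF finite_vars finite_vars] w] .
  then show ?thesis
    using det_op_gsubst[OF _ strict_mono_on_block_map[OF \<beta>(1,2)] Un_upper2 w] gsubst_block_id \<beta>(3)
    by (simp add: image_vars)
qed

lemma det_exp_prime:
  assumes c: "c \<in> grass_alg n (vars Blf s \<union> vars BlF t)"
  shows "det_exp Blf Blf' BlF' t (prime c) = det_op (vars BlF t) c"
proof -
  let ?\<beta> = "(\<lambda>k. if k = Blf' then Blf else k) \<circ> prime_block"
  have "exp_subst Blf Blf' (prime c) = gsubst (map_prod ?\<beta> id) c"
    unfolding exp_subst_eq prime_def
    by (rule gsubst_block_comp[OF _ _ _ c])
      (simp_all add: image_Un image_vars strict_mono_on_block_map less_block_def)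
  then show ?thesis
    using det_op_gsubst_block[of ?\<beta> Blf BlF, OF _ _ _ c] by (simp add: det_exp_apply less_block_def)
qed

lemma unit_exp_prime:
  assumes c: "c \<in> grass_alg n (vars Blf s)"
  shows "unit_exp Blf Blf' (prime c) = F0 c"
proof -
  have "prime c \<in> grass_alg n (vars Blf' s)"
    using gsubst_closed[OF finite_vars strict_mono_on_one_block c, of prime_block] by (simp add: prime_def image_vars)
  then have "unit_exp Blf Blf' (prime c) = exp_subst Blf Blf' (prime c)"
    by (rule unit_exp_eq)
  also have "\<dots> = gsubst (map_prod ((\<lambda>k. if k = Blf' then Blf else k) \<circ> prime_block) id) c"
    unfolding exp_subst_eq prime_def
    by (rule gsubst_block_comp[OF _ _ _ c]) (simp_all add: image_vars strict_mono_on_one_block)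
  also have "\<dots> = c"
    by (rule gsubst_block_id[OF c]) simp
  finally show ?thesis
    using c by (simp add: F0_def gmult_gone)
qed

text \<open>
  The block \<open>F\<close> is not renamed by \<open>exp(f' f\<^sub>*)\<close>, so \<open>det_op\<close> can be applied before the substitution,
  which \<open>unprime\<close> then reverts.
\<close>

lemma unprime_det_exp:
  assumes w: "w \<in> grass_alg n (vars Blf s \<union> vars BlF t)"
  shows "unprime (det_exp Blf' Blf BlF t w) = det_op (vars BlF t) w"
proof -
  let ?\<beta> = "\<lambda>k. if k = Blf then Blf' else k"
  have mono: "strict_mono_on (vars Blf s \<union> vars BlF t) (map_prod ?\<beta> id)"
    by (rule strict_mono_on_block_map) (simp_all add: less_block_def)
  have det: "det_op (vars BlF t) w \<in> grass_alg n (vars Blf s)"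
    using graded_map_closed[OF det_op_graded[OF finite_vars finite_vars] w] .
  have "det_exp Blf' Blf BlF t w = gsubst (map_prod ?\<beta> id) (det_op (vars BlF t) w)"
    using det_op_gsubst[OF _ mono Un_upper2 w] by (simp add: det_exp_apply exp_subst_eq image_vars)
  then have "unprime (det_exp Blf' Blf BlF t w) =
      gsubst (map_prod (unprime_block \<circ> ?\<beta>) id) (det_op (vars BlF t) w)"
    using gsubst_block_comp[OF _ _ _ det, of ?\<beta> unprime_block]
    by (simp add: unprime_def image_vars strict_mono_on_one_block)
  also have "\<dots> = det_op (vars BlF t) w"
    by (rule gsubst_block_id[OF det]) simp
  finally show ?thesis .
qed

lemma unprime_unit_exp:
  assumes w: "w \<in> grass_alg n (vars Blf s)"
  shows "unprime (unit_exp Blf' Blf w) = w"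
proof -
  have "unprime (unit_exp Blf' Blf w) =
      gsubst (map_prod (unprime_block \<circ> (\<lambda>k. if k = Blf then Blf' else k)) id) w"
    unfolding unit_exp_eq[OF w] exp_subst_eq unprime_def
    by (rule gsubst_block_comp[OF _ _ _ w]) (simp_all add: image_vars strict_mono_on_one_block)
  also have "\<dots> = w"
    by (rule gsubst_block_id[OF w]) simp
  finally show ?thesis .
qed

lemma pull_unprime:
  fixes \<phi> :: "'r::{comm_ring,comm_monoid_mult} grass \<Rightarrow> 'r grass"
  assumes \<phi>: "\<And>w. w \<in> grass_alg n V \<Longrightarrow> \<phi> w \<in> grass_alg n W"
    and W: "finite W" "strict_mono_on W (map_prod unprime_block id)" "map_prod unprime_block id ` W \<subseteq> U"
    and \<psi>: "\<And>w. w \<in> grass_alg n V \<Longrightarrow> unprime (\<phi> w) = \<psi> w"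
  shows "pull p (grass_cplx n V d) (grass_cplx n W d') \<phi> (prime_fun n W c) =
         pull p (grass_cplx n V d) (grass_cplx n U d'') \<psi> c"
proof -
  have "pull p (grass_cplx n V d) (grass_cplx n W d') \<phi> (prime_fun n W c) =
      pull p (grass_cplx n V d) (grass_cplx n U d'') (\<lambda>w. unprime (\<phi> w)) c"
    using \<phi> gsubst_gpart[OF W(1,2)] grass_alg_mono[OF W(3) gsubst_closed[OF W(1,2)]]
    by (intro pull_prime_fun) (simp_all add: unprime_def)
  also have "\<dots> = pull p (grass_cplx n V d) (grass_cplx n U d'') \<psi> c"
    by (rule pull_cong) (simp add: \<psi>)
  finally show ?thesis .
qed

section \<open>Morphisms between the four complexes\<close>

text \<open>
  From here on, \<open>d\<close> is the differential on all four collections of variables, and every Grassmann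
  complex below carries its restriction.
\<close>

context
  fixes n s t :: nat and f F :: "nat \<Rightarrow> 'r::{comm_ring,comm_monoid_mult} mpoly" and d :: "'r grass \<Rightarrow> 'r grass"
  assumes f: "\<forall>i<s. f i \<in> Rx n" and F: "\<forall>j<t. F j \<in> Rx n"
    and d: "koszul_differential n (vars Blf s \<union> vars Blf' s \<union> vars BlF t \<union> vars BlF' t) (gval f F) d"
begin

abbreviation (input) "all_vars \<equiv> vars Blf s \<union> vars Blf' s \<union> vars BlF t \<union> vars BlF' t"

lemma gval_closed: "v \<in> all_vars \<Longrightarrow> gval f F v \<in> Rx n"
  using f F by (cases v) (auto simp: vars_def)

lemma differential_subset: "X \<subseteq> all_vars \<Longrightarrow> koszul_differential n X (gval f F) d"
proof (rule koszul_differential_subset[OF d])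
  show "finite all_vars"
    by simp
  show "\<forall>v\<in>all_vars. gval f F v \<in> Rx n"
    by (intro ballI gval_closed)
qed

lemma d_closed: "X \<subseteq> all_vars \<Longrightarrow> w \<in> grass_alg n X \<Longrightarrow> d w \<in> grass_alg n X"
  using graded_map_closed[OF koszul_differential_graded[OF differential_subset]] .

lemma block_map_morphism:
  assumes X: "X \<subseteq> all_vars" and Y: "Y \<subseteq> all_vars" "map_prod \<beta> id ` X \<subseteq> Y"
    and mono: "strict_mono_on X (map_prod \<beta> id)"
    and \<beta>: "\<And>k. unprime_block (\<beta> k) = unprime_block k"
  shows "complex_morphism n 0 (grass_cplx n X d) (grass_cplx n Y d) (gsubst (map_prod \<beta> id))"
proof (rule gsubst_complex_morphism[OF _ mono differential_subset[OF X] differential_subset[OF Y(1)] _ Y(2)])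
  show "finite X" "finite Y"
    using X Y(1) by (auto intro: finite_subset)
  show "\<forall>v\<in>X. gval f F (map_prod \<beta> id v) = gval f F v"
    by (intro ballI gval_block_map \<beta>)
  show "\<forall>v\<in>X. gval f F v \<in> Rx n" "\<forall>v\<in>Y. gval f F v \<in> Rx n"
    using X Y(1) gval_closed by (simp_all only: subset_iff) blast+
qed

lemma exp_subst_morphism:
  assumes X: "X \<subseteq> all_vars" and Y: "Y \<subseteq> all_vars" "map_prod (\<lambda>k. if k = b' then b else k) id ` X \<subseteq> Y"
    and mono: "strict_mono_on X (map_prod (\<lambda>k. if k = b' then b else k) id)"
    and b: "unprime_block b = unprime_block b'"
  shows "complex_morphism n 0 (grass_cplx n X d) (grass_cplx n Y d) (exp_subst b b')"
  unfolding exp_subst_eq by (rule block_map_morphism[OF X Y mono]) (simp add: b)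

lemma det_op_morphism:
  assumes b: "b \<noteq> B" and X: "vars b s \<union> vars B t \<subseteq> all_vars"
  shows "complex_morphism n (of_nat t) (grass_cplx n (vars b s \<union> vars B t) d) (grass_cplx n (vars b s) d)
           (det_op (vars B t))"
proof -
  have "\<forall>v\<in>vars b s \<union> vars B t. gval f F v \<in> Rx n"
    using X gval_closed by blast
  from det_op_complex_morphism[OF differential_subset[OF X] finite_vars finite_vars this vars_disjoint[OF b]]
  show ?thesis
    by (simp only: card_vars)
qed

lemma det_exp_morphism:
  assumes b: "b < B" "b' < B" and b': "unprime_block b = unprime_block b'"
    and X: "vars b s \<union> vars B t \<subseteq> all_vars" "vars b' s \<union> vars B t \<subseteq> all_vars"
  shows "complex_morphism n (of_nat t) (grass_cplx n (vars b' s \<union> vars B t) d) (grass_cplx n (vars b s) d)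
           (det_exp b b' B t)"
proof -
  have "complex_morphism n 0 (grass_cplx n (vars b' s \<union> vars B t) d) (grass_cplx n (vars b s \<union> vars B t) d)
      (exp_subst b b')"
  proof (rule exp_subst_morphism[OF X(2,1) _ _ b'])
    show "map_prod (\<lambda>k. if k = b' then b else k) id ` (vars b' s \<union> vars B t) \<subseteq> vars b s \<union> vars B t"
      using b(2) by (auto simp: image_Un image_vars)
    show "strict_mono_on (vars b' s \<union> vars B t) (map_prod (\<lambda>k. if k = b' then b else k) id)"
      using b by (intro strict_mono_on_block_map) auto
  qed
  from complex_morphism_comp[OF this det_op_morphism[OF less_imp_neq[OF b(1)] X(1)] d_closed[OF X(2)]]
  show ?thesis
    by (simp only: det_exp_apply[abs_def] add_0_left)
qed

lemma prime_morphism: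
  "complex_morphism n 0 (cplx_fF n s t d) (cplx_f'F' n s t d) prime"
  "complex_morphism n 0 (cplx_f n s d) (cplx_f' n s d) prime"
proof -
  have k: "unprime_block (prime_block k) = unprime_block k" for k
    by (cases k) simp_all
  have m: "strict_mono_on (vars Blf s \<union> vars BlF t) (map_prod prime_block id)"
    by (rule strict_mono_on_block_map) (simp_all add: less_block_def)
  show "complex_morphism n 0 (cplx_fF n s t d) (cplx_f'F' n s t d) prime"
    unfolding prime_def by (rule block_map_morphism[OF _ _ _ m k]) (auto simp only: image_Un image_vars prime_block.simps)
  show "complex_morphism n 0 (cplx_f n s d) (cplx_f' n s d) prime"
    unfolding prime_def
    by (rule block_map_morphism[OF _ _ _ strict_mono_on_one_block k]) (auto simp only: image_vars prime_block.simps)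
qed

lemma unit_exp_morphism:
  assumes b: "unprime_block b = unprime_block b'" and X: "vars b' s \<subseteq> all_vars"
    and Y: "Y \<subseteq> all_vars" "vars b s \<subseteq> Y"
  shows "complex_morphism n 0 (grass_cplx n (vars b' s) d) (grass_cplx n Y d) (unit_exp b b')"
proof (rule complex_morphism_cong[OF _ d_closed[OF X] unit_exp_eq])
  have "map_prod (\<lambda>k. if k = b' then b else k) id ` vars b' s \<subseteq> Y"
    using Y(2) by (simp only: image_vars if_True simp_thms)
  then show "complex_morphism n 0 (grass_cplx n (vars b' s) d) (grass_cplx n Y d) (exp_subst b b')"
    by (rule exp_subst_morphism[OF X Y(1) _ strict_mono_on_one_block b])
qed

lemma inclusion_morphism:
  assumes "X \<subseteq> Y" "Y \<subseteq> all_vars"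
  shows "complex_morphism n 0 (grass_cplx n X d) (grass_cplx n Y d) (\<lambda>w. w)"
  unfolding complex_morphism_grass_iff using grass_alg_mono[OF assms(1)] by (auto intro!: graded_mapI)

end

theorem theorem1:
  fixes n s t :: nat
    and f F :: "nat \<Rightarrow> 'r::{comm_ring,comm_monoid_mult} mpoly"
    and d :: "'r grass \<Rightarrow> 'r grass"
  assumes "\<forall>i<s. f i \<in> Rx n"
    and "\<forall>j<t. F j \<in> Rx n"
    and "koszul_differential n (vars Blf s \<union> vars Blf' s \<union> vars BlF t \<union> vars BlF' t) (gval f F) d"
  shows
    "graded_map n (of_nat t) (cplx_f'F' n s t d) (cplx_f n s d) (det_exp Blf Blf' BlF' t) \<and>
     (\<forall>w \<in> car (cplx_f'F' n s t d).
        bracket (of_nat t) (cplx_f'F' n s t d) (cplx_f n s d) (det_exp Blf Blf' BlF' t) w = 0) \<and>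

     graded_map n 0 (cplx_f' n s d) (cplx_fF n s t d) (unit_exp Blf Blf') \<and>
     (\<forall>w \<in> car (cplx_f' n s d).
        bracket 0 (cplx_f' n s d) (cplx_fF n s t d) (unit_exp Blf Blf') w = 0) \<and>

     complex_morphism n (of_nat t) (cplx_fF n s t d) (cplx_f n s d)
        (\<lambda>c. det_exp Blf Blf' BlF' t (prime c)) \<and>
     (\<forall>c \<in> car (cplx_fF n s t d).
        det_exp Blf Blf' BlF' t (prime c) = det_op (vars BlF t) c) \<and>

     complex_morphism n (of_nat t) (dual_cplx (cplx_f n s d)) (dual_cplx (cplx_fF n s t d))
        (\<lambda>c. pull (of_nat t) (cplx_fF n s t d) (cplx_f' n s d)
           (det_exp Blf' Blf BlF t) (prime_fun n (vars Blf' s) c)) \<and>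
     (\<forall>c \<in> car (dual_cplx (cplx_f n s d)).
        pull (of_nat t) (cplx_fF n s t d) (cplx_f' n s d)
          (det_exp Blf' Blf BlF t) (prime_fun n (vars Blf' s) c) =
        pull (of_nat t) (cplx_fF n s t d) (cplx_f n s d) (det_op (vars BlF t)) c) \<and>

     complex_morphism n 0 (cplx_f n s d) (cplx_fF n s t d) (\<lambda>c. unit_exp Blf Blf' (prime c)) \<and>
     (\<forall>c \<in> car (cplx_f n s d). unit_exp Blf Blf' (prime c) = F0 c) \<and>

     complex_morphism n 0 (dual_cplx (cplx_fF n s t d)) (dual_cplx (cplx_f n s d))
        (\<lambda>c. pull 0 (cplx_f n s d) (cplx_f'F' n s t d)
           (unit_exp Blf' Blf) (prime_fun n (vars Blf' s \<union> vars BlF' t) c)) \<and>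
     (\<forall>c \<in> car (dual_cplx (cplx_fF n s t d)).
        pull 0 (cplx_f n s d) (cplx_f'F' n s t d)
          (unit_exp Blf' Blf) (prime_fun n (vars Blf' s \<union> vars BlF' t) c) =
        restrict c (car (cplx_f n s d)))"
proof -
  let ?t = "of_nat t :: bit"
  note diff = differential_subset[OF assms]
  note graded = koszul_differential_graded[OF diff]
  have det: "complex_morphism n ?t (cplx_f'F' n s t d) (cplx_f n s d) (det_exp Blf Blf' BlF' t)"
    "complex_morphism n ?t (cplx_fF n s t d) (cplx_f' n s d) (det_exp Blf' Blf BlF t)"
    by (rule det_exp_morphism[OF assms]; force simp: less_block_def)+
  have unit: "complex_morphism n 0 (cplx_f' n s d) (cplx_fF n s t d) (unit_exp Blf Blf')"
    "complex_morphism n 0 (cplx_f n s d) (cplx_f'F' n s t d) (unit_exp Blf' Blf)"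
    by (rule unit_exp_morphism[OF assms]; force)+
  have detF: "complex_morphism n ?t (cplx_fF n s t d) (cplx_f n s d) (det_op (vars BlF t))"
    by (rule det_op_morphism[OF assms]; force)
  have a: "complex_morphism n ?t (cplx_fF n s t d) (cplx_f n s d) (\<lambda>c. det_exp Blf Blf' BlF' t (prime c))"
    using complex_morphism_comp[OF prime_morphism(1)[OF assms] det(1) d_closed[OF assms]]
    by (simp only: add_0_left) blast
  have c: "complex_morphism n 0 (cplx_f n s d) (cplx_fF n s t d) (\<lambda>c. unit_exp Blf Blf' (prime c))"
    using complex_morphism_comp[OF prime_morphism(2)[OF assms] unit(1) d_closed[OF assms]]
    by (simp only: add_0_left) blast
  note closed = graded_map_closed[OF complex_morphism_grass_iff[THEN iffD1, THEN conjunct1]]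
  \<comment> \<open>Equalities of functions, and not only of values on the dual complex, rewrite inside \<open>complex_morphism\<close>.\<close>
  have b: "(\<lambda>c. pull ?t (cplx_fF n s t d) (cplx_f' n s d) (det_exp Blf' Blf BlF t) (prime_fun n (vars Blf' s) c)) =
      pull ?t (cplx_fF n s t d) (cplx_f n s d) (det_op (vars BlF t))"
    by (intro ext pull_unprime closed[OF det(2)] unprime_det_exp strict_mono_on_one_block finite_vars)
      (simp_all add: image_vars)
  have e: "(\<lambda>c. pull 0 (cplx_f n s d) (cplx_f'F' n s t d) (unit_exp Blf' Blf)
        (prime_fun n (vars Blf' s \<union> vars BlF' t) c)) =
      pull 0 (cplx_f n s d) (cplx_fF n s t d) (\<lambda>w. w)"
    by (intro ext pull_unprime closed[OF unit(2)] unprime_unit_exp strict_mono_on_block_map)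
      (simp_all add: image_Un image_vars less_block_def)
  have b': "complex_morphism n ?t (dual_cplx (cplx_f n s d)) (dual_cplx (cplx_fF n s t d))
      (pull ?t (cplx_fF n s t d) (cplx_f n s d) (det_op (vars BlF t)))"
    by (rule pull_complex_morphism[OF detF graded graded]) auto
  have e': "complex_morphism n 0 (dual_cplx (cplx_fF n s t d)) (dual_cplx (cplx_f n s d))
      (pull 0 (cplx_f n s d) (cplx_fF n s t d) (\<lambda>w. w))"
    by (rule pull_complex_morphism[OF inclusion_morphism[OF assms] graded graded]) auto
  \<comment> \<open>The pullback along an even map carries no sign.\<close>
  have restr: "pull 0 (cplx_f n s d) (cplx_fF n s t d) (\<lambda>w. w) c = restrict c (car (cplx_f n s d))"
    if "c \<in> car (dual_cplx (cplx_fF n s t d))" for c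
  proof -
    have "pull 0 (cplx_f n s d) (cplx_fF n s t d) (\<lambda>w. w) c = (\<lambda>w \<in> grass_alg n (vars Blf s). c (twist 0 w))"
      using that by (rule pull_apply) (rule grass_alg_mono[OF Un_upper1])
    then show ?thesis
      by simp
  qed
  show ?thesis
    using det(1) unit(1) a c b' e' restr fun_cong[OF b] fun_cong[OF e]
    unfolding b e by (simp add: complex_morphism_def det_exp_prime unit_exp_prime)
qed

end
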